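(* The following hold. (a) If $w$ is a word in which no letter appears both at an odd index and at an even index, then $w$ is $d$-stackable for every positive integer $d$. (b) If $w$ is $d$-stackable and $k$ is a positive integer, then the word $w'$ obtained from $w$ by repeating each letter $k$ times consecutively (e.g. $\mathsf{AABC}$ becomes $\mathsf{AAAABBCC}$ for $k=2$) is $d$-stackable. (c) If $w$ is a word with at most four characters, then $w$ is $2$-stackable if and only if $w$ is not of the form $\mathsf{A}\mathsf{B}\mathsf{B}\mathsf{B}$ or $\mathsf{B}\mathsf{B}\mathsf{B}\mathsf{A}$ for some distinct letters $\mathsf A,\mathsf B$. (d) For every integer $\ell>3$, the word $\mathsf{A}\mathsf{B}^{\ell-1}$ (one $\mathsf A$ followed by $\ell-1$ copies of a distinct letter $\mathsf B$) is not $2$-stackable.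
   Context: A word is a finite string $w=w_0w_1\cdots w_{\ell-1}$ of letters from some alphabet; words are assumed to contain at least two distinct letters. A $d$-dimensional grid $\Gamma$ of shape $G=\prod_{i=1}^d\mathbb Z/n_i\mathbb Z$ ($n_i$ positive integers) is a map $\Gamma\colon G\to\Sigma$ to an alphabet; its size is $|G|$. An appearance of $w$ in $\Gamma$ is a pair $(p,\mathbf v)\in G\times(\{-1,0,1\}^d\setminus\{\mathbf 0\})$ with $\Gamma(p+i\mathbf v)=w_i$ for all $0\le i<\ell$. The concentration $c_d(w,\Gamma)$ is the number of appearances divided by $|G|$, and $C_d(w)$ is the supremum of $c_d(w,\Gamma)$ over all $d$-dimensional grids. A word $w$ is called $d$-stackable if $C_d(w)=3^{d-1}C_1(w)$. *)

theory Defs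
  imports Complex_Main "HOL-Library.FuncSet"
begin

definition is_word :: "'a list \<Rightarrow> bool" where
  "is_word w \<longleftrightarrow> (\<exists>a\<in>set w. \<exists>b\<in>set w. a \<noteq> b)"

text \<open>
  The group \<open>\<Prod>i<d. \<int>/n\<^sub>i\<int>\<close>, each factor represented by its least nonnegative residues;
  coordinates are indexed from \<open>0\<close>.
\<close>

definition torus :: "nat \<Rightarrow> (nat \<Rightarrow> nat) \<Rightarrow> (nat \<Rightarrow> int) set" where
  "torus d n = (\<Pi>\<^sub>E i\<in>{..<d}. {0..<int (n i)})"

text \<open>
  Directions are integer vectors, not elements of the torus: they stay distinct even when they
  become equal modulo small \<open>n\<^sub>i\<close>.
\<close>

definition directions :: "nat \<Rightarrow> (nat \<Rightarrow> int) set" where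
  "directions d = (\<Pi>\<^sub>E i\<in>{..<d}. {-1, 0, 1}) - {\<lambda>i\<in>{..<d}. 0}"

definition walk :: "nat \<Rightarrow> (nat \<Rightarrow> nat) \<Rightarrow> (nat \<Rightarrow> int) \<Rightarrow> (nat \<Rightarrow> int) \<Rightarrow> nat \<Rightarrow> (nat \<Rightarrow> int)" where
  "walk d n p v i = (\<lambda>j\<in>{..<d}. (p j + int i * v j) mod int (n j))"

text \<open>A grid of shape \<open>torus d n\<close> is a function \<open>\<Gamma>\<close>, of which only the values on the torus matter.\<close>

definition appearances ::
    "nat \<Rightarrow> (nat \<Rightarrow> nat) \<Rightarrow> ((nat \<Rightarrow> int) \<Rightarrow> 'a) \<Rightarrow> 'a list \<Rightarrow> ((nat \<Rightarrow> int) \<times> (nat \<Rightarrow> int)) set" where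
  "appearances d n \<Gamma> w =
     {(p, v) \<in> torus d n \<times> directions d. \<forall>i<length w. \<Gamma> (walk d n p v i) = w ! i}"

definition grid_concentration ::
    "nat \<Rightarrow> (nat \<Rightarrow> nat) \<Rightarrow> ((nat \<Rightarrow> int) \<Rightarrow> 'a) \<Rightarrow> 'a list \<Rightarrow> real" where
  "grid_concentration d n \<Gamma> w = real (card (appearances d n \<Gamma> w)) / real (card (torus d n))"

definition grid_concentrations :: "nat \<Rightarrow> 'a list \<Rightarrow> real set" where
  "grid_concentrations d w = {grid_concentration d n \<Gamma> w | n \<Gamma>. \<forall>i<d. 0 < n i}"

definition concentration :: "nat \<Rightarrow> 'a list \<Rightarrow> real" where
  "concentration d w = Sup (grid_concentrations d w)"

definition stackable :: "nat \<Rightarrow> 'a list \<Rightarrow> bool" where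
  "stackable d w \<longleftrightarrow> concentration d w = 3 ^ (d - 1) * concentration 1 w"

definition repeat_letters :: "nat \<Rightarrow> 'a list \<Rightarrow> 'a list" where
  "repeat_letters k w = concat (map (replicate k) w)"

text \<open>The supremum defining \<^const>\<open>concentration\<close> is over a nonempty set that is bounded above.\<close>

lemma grid_concentrations_nonempty: "grid_concentrations d w \<noteq> {}"
  unfolding grid_concentrations_def by (auto intro: exI[of _ "\<lambda>_. 1"])

lemma finite_torus: "finite (torus d n)"
  unfolding torus_def by (intro finite_PiE) auto

lemma finite_directions: "finite (directions d)"
  unfolding directions_def by (intro finite_Diff finite_PiE) auto

lemma grid_concentration_le: "grid_concentration d n \<Gamma> w \<le> real (card (directions d))"
proof -
  have "card (appearances d n \<Gamma> w) \<le> card (torus d n \<times> directions d)"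
    by (rule card_mono) (auto simp: appearances_def finite_torus finite_directions)
  then have "real (card (appearances d n \<Gamma> w)) \<le> real (card (directions d)) * real (card (torus d n))"
    by (simp add: card_cartesian_product mult.commute flip: of_nat_mult)
  then show ?thesis
    by (cases "card (torus d n) = 0") (simp_all add: grid_concentration_def field_simps)
qed

lemma grid_concentrations_bdd_above: "bdd_above (grid_concentrations d w)"
  unfolding grid_concentrations_def by (rule bdd_aboveI) (auto intro: grid_concentration_le)

end

theory Submission
  imports Defs "HOL-Combinatorics.Cycles"
begin

text \<open>
  Extending a one-dimensional grid constantly in the other directions shows that
  \<open>C\<^sub>d(w) \<ge> 3\<^sup>d\<^sup>-\<^sup>1 C\<^sub>1(w)\<close>, so stackability is an upper bound on \<open>C\<^sub>d(w)\<close>.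

  (a) An appearance only uses edges of the king graph between odd and even letters. Cutting each
  line at the remaining edges and folding the pieces into closed walks shows that there are at most
  \<open>C\<^sub>1(w)\<close> appearances per cut edge, and a cut has at most \<open>3\<^sup>d\<^sup>-\<^sup>1\<close> edges per cell because the
  convolution with the \<open>3 \<times> \<dots> \<times> 3\<close> box has no eigenvalue below \<open>-3\<^sup>d\<^sup>-\<^sup>1\<close>.

  (b) The cells at distances divisible by \<open>k\<close> form grids in which each appearance of the stretched
  word leaves \<open>k\<close> appearances of the original one.

  (c) By reversal and identification of letters, everything reduces to \<open>AAB\<close> and \<open>AABC\<close>, which
  are handled by linear programming duality on \<open>3 \<times> 3\<close> windows.

  (d) In one dimension the concentration is at most \<open>2/\<ell>\<close>. Placing \<open>A\<close> on a plane lattice of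
  index \<open>m\<close> coprime to 6 with \<open>\<ell> \<le> m < 4\<ell>/3\<close> makes all 8 directions from every \<open>A\<close> appearances; only
  \<open>\<ell> = 8\<close> admits no such \<open>m\<close>.
\<close>

section \<open>Translations of the torus\<close>

text \<open>The displacement \<open>u\<close> is an integer vector that need not be reduced, so that
  sums and multiples of directions are formed before any reduction modulo \<open>n\<close>.\<close>

definition tadd :: "nat \<Rightarrow> (nat \<Rightarrow> nat) \<Rightarrow> (nat \<Rightarrow> int) \<Rightarrow> (nat \<Rightarrow> int) \<Rightarrow> nat \<Rightarrow> int" where
  "tadd d n p u = (\<lambda>j\<in>{..<d}. (p j + u j) mod int (n j))"

lemma walk_eq_tadd: "walk d n p v i = tadd d n p (\<lambda>j. int i * v j)"
  by (simp add: walk_def tadd_def)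

lemma tadd_cong:
  assumes "\<And>j. j < d \<Longrightarrow> u j = v j"
  shows "tadd d n p u = tadd d n p v"
  using assms by (auto simp: tadd_def)

lemma tadd_tadd: "tadd d n (tadd d n p u) v = tadd d n p (\<lambda>j. u j + v j)"
  by (auto simp: tadd_def mod_simps add.assoc)

lemma tadd_in_torus: "\<forall>j<d. 0 < n j \<Longrightarrow> tadd d n p u \<in> torus d n"
  by (auto simp: tadd_def torus_def)

lemma tadd_zero:
  assumes "p \<in> torus d n" and "\<And>j. j < d \<Longrightarrow> u j = 0"
  shows "tadd d n p u = p"
proof
  fix j
  show "tadd d n p u j = p j"
    using assms by (cases "j < d") (auto simp: tadd_def torus_def PiE_iff extensional_def)
qed

lemma tadd_tadd_minus:
  assumes "\<forall>j<d. 0 < n j" "p \<in> torus d n"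
  shows "tadd d n (tadd d n p u) (\<lambda>j. - u j) = p"
  by (simp add: tadd_tadd tadd_zero[OF assms(2)])

lemma bij_betw_tadd:
  assumes "\<forall>j<d. 0 < n j"
  shows "bij_betw (\<lambda>p. tadd d n p u) (torus d n) (torus d n)"
proof (rule bij_betwI[where g = "\<lambda>p. tadd d n p (\<lambda>j. - u j)"])
qed (auto simp: tadd_in_torus assms tadd_tadd tadd_zero)

lemma sum_tadd:
  assumes "\<forall>j<d. 0 < n j"
  shows "(\<Sum>p\<in>torus d n. g (tadd d n p u)) = (\<Sum>p\<in>torus d n. g p)"
  by (rule sum.reindex_bij_betw[OF bij_betw_tadd[OF assms]])

lemma card_torus: "card (torus d n) = (\<Prod>i<d. n i)"
  by (simp add: torus_def card_PiE)

lemma card_torus_pos: "\<forall>j<d. 0 < n j \<Longrightarrow> 0 < card (torus d n)"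
  by (simp add: card_torus prod_pos)

lemma finite_appearances: "finite (appearances d n \<Gamma> w)"
  by (rule finite_subset[of _ "torus d n \<times> directions d"])
     (auto simp: appearances_def finite_torus finite_directions)

lemma mem_appearances:
  "(p, v) \<in> appearances d n \<Gamma> w \<longleftrightarrow> p \<in> torus d n \<and> v \<in> directions d \<and>
     (\<forall>i<length w. \<Gamma> (tadd d n p (\<lambda>j. int i * v j)) = w ! i)"
  by (auto simp: appearances_def walk_eq_tadd)

lemma card_appearances_sum:
  "card (appearances d n \<Gamma> w) = (\<Sum>p\<in>torus d n. \<Sum>v\<in>directions d.
     of_bool (\<forall>i<length w. \<Gamma> (tadd d n p (\<lambda>j. int i * v j)) = w ! i))"
proof -
  have "appearances d n \<Gamma> w = (SIGMA p:torus d n.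
      {v \<in> directions d. \<forall>i<length w. \<Gamma> (tadd d n p (\<lambda>j. int i * v j)) = w ! i})"
    by (auto simp: appearances_def walk_eq_tadd)
  then show ?thesis
    by (simp add: card_SigmaI finite_torus finite_directions Int_def)
qed

section \<open>Concentrations\<close>

lemma appearances_le_concentration:
  assumes "\<forall>i<d. 0 < n i"
  shows "real (card (appearances d n \<Gamma> w)) \<le> concentration d w * real (card (torus d n))"
proof -
  have "grid_concentration d n \<Gamma> w \<le> concentration d w"
    unfolding concentration_def
    by (rule cSup_upper[OF _ grid_concentrations_bdd_above])
       (use assms in \<open>auto simp: grid_concentrations_def\<close>)
  then show ?thesis
    using card_torus_pos[OF assms] by (simp add: grid_concentration_def divide_le_eq)
qed

lemma concentration_leI:
  assumes "\<And>n \<Gamma>. \<forall>i<d. 0 < n i \<Longrightarrow>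
    real (card (appearances d n \<Gamma> w)) \<le> c * real (card (torus d n))"
  shows "concentration d w \<le> c"
  unfolding concentration_def
proof (rule cSup_least[OF grid_concentrations_nonempty])
  fix x assume "x \<in> grid_concentrations d w"
  then obtain n \<Gamma> where x: "x = grid_concentration d n \<Gamma> w" "\<forall>i<d. 0 < n i"
    by (auto simp: grid_concentrations_def)
  then show "x \<le> c"
    using assms[OF x(2), of \<Gamma>] card_torus_pos[OF x(2)]
    by (simp add: grid_concentration_def divide_le_eq)
qed

lemma concentration_geI:
  assumes "\<forall>i<d. 0 < n i" "c * real (card (torus d n)) \<le> real (card (appearances d n \<Gamma> w))"
  shows "c \<le> concentration d w"
proof -
  have "c * real (card (torus d n)) \<le> concentration d w * real (card (torus d n))"
    using assms appearances_le_concentration[OF assms(1), of \<Gamma> w] by linarith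
  then show ?thesis using card_torus_pos[OF assms(1)] by simp
qed

lemma concentration_nonneg: "0 \<le> concentration d w"
  by (rule concentration_geI[of d "\<lambda>_. 1"]) auto

section \<open>Reversal, prefixes and identification of letters\<close>

definition neg_dir :: "nat \<Rightarrow> (nat \<Rightarrow> int) \<Rightarrow> nat \<Rightarrow> int" where
  "neg_dir d v = (\<lambda>j\<in>{..<d}. - v j)"

lemma neg_dir_in_directions: "v \<in> directions d \<Longrightarrow> neg_dir d v \<in> directions d"
proof -
  assume v: "v \<in> directions d"
  then have *: "neg_dir d v \<in> (\<Pi>\<^sub>E i\<in>{..<d}. {-1, 0, 1})"
    by (fastforce simp: directions_def neg_dir_def PiE_iff)
  have "neg_dir d v \<noteq> (\<lambda>i\<in>{..<d}. 0)"
  proof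
    assume eq: "neg_dir d v = (\<lambda>i\<in>{..<d}. 0)"
    have "v i = (\<lambda>i\<in>{..<d}. 0) i" for i
      using fun_cong[OF eq, of i] v
      by (cases "i < d") (auto simp: neg_dir_def directions_def PiE_iff extensional_def)
    then show False using v by (auto simp: directions_def)
  qed
  then show ?thesis using * by (simp add: directions_def)
qed

lemma neg_dir_neg_dir: "v \<in> directions d \<Longrightarrow> neg_dir d (neg_dir d v) = v"
  by (rule ext) (auto simp: neg_dir_def directions_def PiE_iff extensional_def)

lemma neg_dir_apply: "j < d \<Longrightarrow> neg_dir d v j = - v j"
  by (simp add: neg_dir_def)

text \<open>Reading an appearance from its last cell in the opposite direction undoes itself when
  repeated, so the map \<open>f\<close> is injective.\<close>

lemma card_appearances_rev_le:
  assumes "\<forall>i<d. 0 < n i"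
  shows "card (appearances d n \<Gamma> w) \<le> card (appearances d n \<Gamma> (rev w))"
proof (rule card_inj_on_le[OF _ _ finite_appearances])
  define l where "l = int (length w) - 1"
  define f where "f = (\<lambda>(p, v). (tadd d n p (\<lambda>j. l * v j), neg_dir d v))"
  show "inj_on f (appearances d n \<Gamma> w)"
  proof (rule inj_on_inverseI[where g = f])
    fix x assume "x \<in> appearances d n \<Gamma> w"
    then obtain p v where x: "x = (p, v)" "p \<in> torus d n" "v \<in> directions d"
      by (auto simp: appearances_def)
    then show "f (f x) = x"
      by (auto simp: f_def tadd_tadd neg_dir_neg_dir neg_dir_apply intro!: tadd_zero)
  qed
  show "f ` appearances d n \<Gamma> w \<subseteq> appearances d n \<Gamma> (rev w)"
  proof (rule image_subsetI)
    fix x assume x': "x \<in> appearances d n \<Gamma> w"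
    obtain p v where x: "x = (p, v)" by (cases x)
    have "\<Gamma> (tadd d n (tadd d n p (\<lambda>j. l * v j)) (\<lambda>j. int i * neg_dir d v j)) = rev w ! i"
      if i: "i < length w" for i
    proof -
      have "tadd d n (tadd d n p (\<lambda>j. l * v j)) (\<lambda>j. int i * neg_dir d v j)
          = tadd d n p (\<lambda>j. int (length w - Suc i) * v j)"
        unfolding tadd_tadd
        by (rule tadd_cong) (use i in \<open>simp add: l_def neg_dir_apply of_nat_diff algebra_simps\<close>)
      moreover have "\<Gamma> (tadd d n p (\<lambda>j. int (length w - Suc i) * v j)) = w ! (length w - Suc i)"
        using x' i unfolding x mem_appearances by (metis diff_Suc_less length_greater_0_conv list.size(3) not_less0)
      ultimately show ?thesis
        using i by (simp add: rev_nth)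
    qed
    then show "f x \<in> appearances d n \<Gamma> (rev w)"
      using x' by (simp add: x f_def mem_appearances tadd_in_torus assms neg_dir_in_directions)
  qed
qed

lemma card_appearances_rev:
  assumes "\<forall>i<d. 0 < n i"
  shows "card (appearances d n \<Gamma> (rev w)) = card (appearances d n \<Gamma> w)"
  using card_appearances_rev_le[OF assms, of \<Gamma> w] card_appearances_rev_le[OF assms, of \<Gamma> "rev w"]
  by simp

lemma concentration_rev: "concentration d (rev w) = concentration d w"
proof -
  have "grid_concentrations d (rev w) = grid_concentrations d w"
    unfolding grid_concentrations_def grid_concentration_def
    by (auto simp: card_appearances_rev) (metis card_appearances_rev)+
  then show ?thesis by (simp add: concentration_def)
qed

lemma stackable_rev: "stackable d (rev w) \<longleftrightarrow> stackable d w"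
  by (simp add: stackable_def concentration_rev)

text \<open>Dropping the tail of a word keeps every appearance. This passes the bound for
  \<open>AAB\<close> on to four-letter words.\<close>

lemma concentration_append_le: "concentration d (u @ w) \<le> concentration d u"
proof (rule concentration_leI)
  fix n :: "nat \<Rightarrow> nat" and \<Gamma> :: "(nat \<Rightarrow> int) \<Rightarrow> 'a" assume n: "\<forall>i<d. 0 < n i"
  have "appearances d n \<Gamma> (u @ w) \<subseteq> appearances d n \<Gamma> u"
    by (auto simp: appearances_def nth_append)
  then have "card (appearances d n \<Gamma> (u @ w)) \<le> card (appearances d n \<Gamma> u)"
    by (intro card_mono finite_appearances)
  then show "real (card (appearances d n \<Gamma> (u @ w))) \<le> concentration d u * real (card (torus d n))"
    using appearances_le_concentration[OF n, of \<Gamma> u] by linarith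
qed

text \<open>Identifying letters so that a word becomes a palindrome lets both of its orientations be
  counted as appearances of the image.\<close>

lemma concentration_map_palindrome:
  fixes h :: "'a \<Rightarrow> 'b"
  assumes "map h (rev w) = map h w" "rev w \<noteq> w"
  shows "2 * concentration d w \<le> concentration d (map h w)"
proof -
  have "concentration d w \<le> concentration d (map h w) / 2"
  proof (rule concentration_leI)
    fix n :: "nat \<Rightarrow> nat" and \<Gamma> :: "(nat \<Rightarrow> int) \<Rightarrow> 'a" assume n: "\<forall>i<d. 0 < n i"
    have disj: "appearances d n \<Gamma> w \<inter> appearances d n \<Gamma> (rev w) = {}"
    proof -
      have False if "(p, v) \<in> appearances d n \<Gamma> w" "(p, v) \<in> appearances d n \<Gamma> (rev w)" for p v
        using that assms(2) by (auto simp: mem_appearances intro!: nth_equalityI)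
      then show ?thesis by auto
    qed
    have sub: "appearances d n \<Gamma> u \<subseteq> appearances d n (h \<circ> \<Gamma>) (map h u)" for u
      by (auto simp: appearances_def)
    have "2 * card (appearances d n \<Gamma> w) = card (appearances d n \<Gamma> w \<union> appearances d n \<Gamma> (rev w))"
      by (simp add: card_Un_disjoint[OF finite_appearances finite_appearances disj]
          card_appearances_rev[OF n])
    also have "\<dots> \<le> card (appearances d n (h \<circ> \<Gamma>) (map h w))"
      using sub[of w] sub[of "rev w"] assms(1) by (intro card_mono finite_appearances) auto
    finally show "real (card (appearances d n \<Gamma> w)) \<le>
        concentration d (map h w) / 2 * real (card (torus d n))"
      using appearances_le_concentration[OF n, of "h \<circ> \<Gamma>" "map h w"] by linarith
  qed
  then show ?thesis by simp
qed

section \<open>One-dimensional grids\<close>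

text \<open>Dimension one is treated on integers instead of functions on \<open>{..<1}\<close>; the
  step \<open>s\<close> will be 1 or -1.\<close>

definition line_hits :: "nat \<Rightarrow> (int \<Rightarrow> 'a) \<Rightarrow> 'a list \<Rightarrow> int \<Rightarrow> int set" where
  "line_hits m h w s = {x \<in> {0..<int m}. \<forall>i<length w. h ((x + int i * s) mod int m) = w ! i}"

lemma finite_line_hits: "finite (line_hits m h w s)"
  by (rule finite_subset[of _ "{0..<int m}"]) (auto simp: line_hits_def)

lemma torus_1: "torus 1 n = (\<lambda>x. \<lambda>j\<in>{..<1}. x) ` {0..<int (n 0)}"
proof -
  have "p \<in> (\<lambda>x. \<lambda>j\<in>{..<1}. x) ` {0..<int (n 0)}" if "p \<in> torus 1 n" for p
  proof (rule image_eqI[where x = "p 0"])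
    show "p = (\<lambda>j\<in>{..<1}. p 0)"
      using that by (auto simp: torus_def PiE_iff extensional_def fun_eq_iff)
  qed (use that in \<open>auto simp: torus_def PiE_iff\<close>)
  moreover have "(\<lambda>j\<in>{..<1}. x) \<in> torus 1 n" if "x \<in> {0..<int (n 0)}" for x
    using that by (auto simp: torus_def PiE_iff)
  ultimately show ?thesis by blast
qed

lemma directions_1: "directions 1 = {\<lambda>j\<in>{..<1}. 1, \<lambda>j\<in>{..<1}. -1}"
proof -
  have "v \<in> {\<lambda>j\<in>{..<1}. 1, \<lambda>j\<in>{..<1}. -1}" if "v \<in> directions 1" for v
  proof -
    have "v = (\<lambda>j\<in>{..<1}. v 0)" "v 0 \<in> {-1, 0, 1}" "v \<noteq> (\<lambda>j\<in>{..<1}. 0)"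
      using that by (auto simp: directions_def PiE_iff extensional_def fun_eq_iff)
    then show ?thesis by (metis insertE insertI1 insertI2 singletonD)
  qed
  moreover have "(\<lambda>j\<in>{..<1}. s) \<in> directions 1" if "s \<noteq> 0" "s \<in> {-1, 0, 1}" for s
    using that by (auto simp: directions_def dest: fun_cong[of _ _ 0])
  ultimately show ?thesis by auto
qed

lemma card_appearances_1:
  "card (appearances 1 n \<Gamma> w) =
     card (line_hits (n 0) (\<lambda>x. \<Gamma> (\<lambda>j\<in>{..<1}. x)) w 1) +
     card (line_hits (n 0) (\<lambda>x. \<Gamma> (\<lambda>j\<in>{..<1}. x)) w (- 1))"
proof -
  define c :: "int \<Rightarrow> nat \<Rightarrow> int" where "c = (\<lambda>x. \<lambda>j\<in>{..<1}. x)"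
  define h where "h = (\<lambda>x. \<Gamma> (c x))"
  have c_fold: "(\<lambda>j\<in>{..<1}. x) = c x" for x by (simp add: c_def)
  have c0: "c x 0 = x" for x by (simp add: c_def)
  have inj: "inj c" by (metis c0 injI)
  have tadd: "tadd 1 n (c x) (\<lambda>j. i * c s j) = c ((x + i * s) mod int (n 0))" for x i s
    by (auto simp: tadd_def c_def)
  have "appearances 1 n \<Gamma> w = (\<lambda>x. (c x, c 1)) ` line_hits (n 0) h w 1 \<union>
      (\<lambda>x. (c x, c (- 1))) ` line_hits (n 0) h w (- 1)"
  proof -
    have "(p, v) \<in> appearances 1 n \<Gamma> w \<longleftrightarrow> (p, v) \<in> (\<lambda>x. (c x, c 1)) ` line_hits (n 0) h w 1 \<union>
      (\<lambda>x. (c x, c (- 1))) ` line_hits (n 0) h w (- 1)" for p v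
      unfolding mem_appearances torus_1 directions_1 line_hits_def h_def
      by (auto simp: c_fold tadd simp del: One_nat_def)
    then show ?thesis by auto
  qed
  also have "card \<dots> = card (line_hits (n 0) h w 1) + card (line_hits (n 0) h w (- 1))"
  proof (subst card_Un_disjoint)
    show "(\<lambda>x. (c x, c 1)) ` line_hits (n 0) h w 1 \<inter> (\<lambda>x. (c x, c (- 1))) ` line_hits (n 0) h w (- 1) = {}"
      by (auto dest: injD[OF inj])
  qed (auto simp: finite_line_hits inj_on_def intro!: arg_cong2[where f = "(+)"] card_image dest: injD[OF inj])
  finally show ?thesis by (simp add: h_def c_def)
qed

lemma card_torus_1: "card (torus 1 n) = n 0"
  by (simp add: card_torus)

lemma line_hits_le_concentration:
  assumes "0 < m"
  shows "real (card (line_hits m h w 1) + card (line_hits m h w (- 1))) \<le> concentration 1 w * real m"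
  using appearances_le_concentration[of 1 "\<lambda>_. m" "\<lambda>p. h (p 0)" w] assms
    card_appearances_1[of "\<lambda>_. m" "\<lambda>p. h (p 0)" w]
  by (simp add: card_torus_1 flip: One_nat_def)

lemma concentration_1_leI:
  assumes "\<And>m h. 0 < m \<Longrightarrow>
    real (card (line_hits m h w 1) + card (line_hits m h w (- 1))) \<le> c * real m"
  shows "concentration 1 w \<le> c"
  by (rule concentration_leI)
     (use assms in \<open>simp add: card_torus_1 card_appearances_1 del: One_nat_def\<close>)

lemma concentration_1_geI:
  assumes "0 < m" "c * real m \<le> real (card (line_hits m h w 1) + card (line_hits m h w (- 1)))"
  shows "c \<le> concentration 1 w"
  using line_hits_le_concentration[OF assms(1), of h w] assms
  by (meson mult_right_le_imp_le of_nat_0_less_iff order_trans)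

text \<open>In a grid that is constant in the other coordinates an appearance survives any choice of
  the other \<open>d - 1\<close> components of its direction.\<close>

lemma concentration_ge_stack:
  assumes "d \<ge> 1"
  shows "3 ^ (d - 1) * concentration 1 w \<le> concentration d w"
proof -
  have "concentration 1 w \<le> concentration d w / 3 ^ (d - 1)"
  proof (rule concentration_leI)
    fix n :: "nat \<Rightarrow> nat" and \<Gamma> :: "(nat \<Rightarrow> int) \<Rightarrow> 'a" assume n: "\<forall>i<1. 0 < n i"
    \<comment> \<open>Length 1 in the other coordinates adds no cells. Directions are integer
      vectors, so the choices in \<open>P\<close> still count as different ones.\<close>
    define n' where "n' i = (if i = 0 then n 0 else 1)" for i :: nat
    define \<Gamma>' where "\<Gamma>' p = \<Gamma> (\<lambda>j\<in>{..<1}. p 0)" for p :: "nat \<Rightarrow> int"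
    define P where "P = (\<Pi>\<^sub>E i\<in>{1..<d}. {-1, 0, 1 :: int})"
    define f where "f = (\<lambda>((p :: nat \<Rightarrow> int, v :: nat \<Rightarrow> int), u). (\<lambda>j\<in>{..<d}. if j = 0 then p 0 else 0 :: int,
      \<lambda>j\<in>{..<d}. if j = 0 then v 0 else u j :: int))"
    have n': "\<forall>i<d. 0 < n' i" using n by (simp add: n'_def)
    have "card (torus d n') = n 0"
    proof -
      have "(\<Prod>i<d. n' i) = (\<Prod>i\<in>{0}. n' i)"
        by (rule prod.mono_neutral_right) (use assms in \<open>auto simp: n'_def\<close>)
      then show ?thesis by (simp add: card_torus n'_def)
    qed
    have inj: "inj_on f (appearances 1 n \<Gamma> w \<times> P)"
    proof (rule inj_onI)
      fix x y assume xy: "x \<in> appearances 1 n \<Gamma> w \<times> P" "y \<in> appearances 1 n \<Gamma> w \<times> P" "f x = f y"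
      obtain p v u p' v' u' where x: "x = ((p, v), u)" and y: "y = ((p', v'), u')"
        by (metis surj_pair)
      have pv: "(p, v) \<in> appearances 1 n \<Gamma> w" "u \<in> P" and pv': "(p', v') \<in> appearances 1 n \<Gamma> w" "u' \<in> P"
        and eq: "f ((p, v), u) = f ((p', v'), u')"
        using xy by (auto simp: x y)
      from eq have e1: "(\<lambda>j\<in>{..<d}. if j = 0 then p 0 else 0) = (\<lambda>j\<in>{..<d}. if j = 0 then p' 0 else 0)"
        and e2: "(\<lambda>j\<in>{..<d}. if j = 0 then v 0 else u j) = (\<lambda>j\<in>{..<d}. if j = 0 then v' 0 else u' j)"
        by (auto simp: f_def)
      have "p 0 = p' 0" "v 0 = v' 0"
        using fun_cong[OF e1, of 0] fun_cong[OF e2, of 0] assms by auto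
      moreover have "u j = u' j" for j
        using fun_cong[OF e2, of j] pv(2) pv'(2)
        by (cases "j \<in> {1..<d}") (auto simp: P_def PiE_iff extensional_def)
      moreover have "q j = undefined" if "q \<in> torus 1 n \<union> directions 1" "0 < j" for q j
        using that by (auto simp: torus_def directions_def PiE_iff extensional_def)
      ultimately show "x = y"
        using pv pv' by (auto simp: x y appearances_def fun_eq_iff) (metis UnCI gr_zeroI)+
    qed
    have img: "f ` (appearances 1 n \<Gamma> w \<times> P) \<subseteq> appearances d n' \<Gamma>' w"
    proof (rule image_subsetI, clarify)
      fix p v u assume pv: "(p, v) \<in> appearances 1 n \<Gamma> w" "u \<in> P"
      have t: "(\<lambda>j\<in>{..<d}. if j = 0 then p 0 else 0) \<in> torus d n'"
        using pv by (auto simp: appearances_def torus_def n'_def)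
      have v0: "v 0 \<in> {-1, 1}" using pv by (auto simp: appearances_def directions_1 simp del: One_nat_def)
      have dir: "(\<lambda>j\<in>{..<d}. if j = 0 then v 0 else u j) \<in> directions d"
      proof -
        have "(\<lambda>j\<in>{..<d}. if j = 0 then v 0 else u j) \<noteq> (\<lambda>j\<in>{..<d}. 0)"
          using v0 assms by (auto dest: fun_cong[of _ _ 0])
        then show ?thesis using v0 pv(2)
          by (auto simp: directions_def P_def PiE_iff)
      qed
      have "\<Gamma>' (tadd d n' (\<lambda>j\<in>{..<d}. if j = 0 then p 0 else 0)
          (\<lambda>j. int i * (\<lambda>j\<in>{..<d}. if j = 0 then v 0 else u j) j)) = \<Gamma> (tadd 1 n p (\<lambda>j. int i * v j))" for i
        using assms unfolding \<Gamma>'_def tadd_def by (intro arg_cong[where f = \<Gamma>]) (auto simp: n'_def)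
      then show "f ((p, v), u) \<in> appearances d n' \<Gamma>' w"
        using pv t dir by (simp add: f_def mem_appearances del: One_nat_def)
    qed
    have "card (appearances 1 n \<Gamma> w) * 3 ^ (d - 1) = card (appearances 1 n \<Gamma> w \<times> P)"
      by (simp add: card_cartesian_product P_def card_PiE numeral_3_eq_3)
    also have "\<dots> \<le> card (appearances d n' \<Gamma>' w)"
      by (rule card_inj_on_le[OF inj img finite_appearances])
    finally have "real (card (appearances 1 n \<Gamma> w)) * 3 ^ (d - 1) \<le> real (card (appearances d n' \<Gamma>' w))"
      by (metis of_nat_le_iff of_nat_mult of_nat_numeral of_nat_power)
    then show "real (card (appearances 1 n \<Gamma> w)) \<le> concentration d w / 3 ^ (d - 1) * real (card (torus 1 n))"
      using appearances_le_concentration[OF n', of \<Gamma>' w] \<open>card (torus d n') = n 0\<close>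
      by (simp add: card_torus_1 field_simps del: One_nat_def)
  qed
  then show ?thesis by (simp add: field_simps)
qed

lemma stackable_iff_le:
  "d \<ge> 1 \<Longrightarrow> stackable d w \<longleftrightarrow> concentration d w \<le> 3 ^ (d - 1) * concentration 1 w"
  unfolding stackable_def using concentration_ge_stack[of d w] by linarith

section \<open>Words read along the orbits of a permutation\<close>

text \<open>Double counting: every power of \<open>T\<close> is a bijection of \<open>E\<close>, so
  each of the \<open>N\<close> exponents contributes \<open>card A\<close>.\<close>

lemma sum_card_funpow_vimage:
  assumes "finite E" "T permutes E" "A \<subseteq> E"
  shows "(\<Sum>e\<in>E. card {x \<in> {0..<int N}. (T ^^ nat x) e \<in> A}) = N * card A"
proof -
  have A: "card {e \<in> E. (T ^^ k) e \<in> A} = card A" for k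
  proof -
    have p: "(T ^^ k) permutes E" by (rule permutes_funpow[OF assms(2)])
    have "(T ^^ k) ` {e \<in> E. (T ^^ k) e \<in> A} = A"
      using assms(3) permutes_image[OF p] by (auto simp: image_iff set_eq_iff) (metis subsetD)
    then show ?thesis
      by (metis card_image inj_on_subset permutes_inj[OF p] subset_UNIV)
  qed
  have "(\<Sum>e\<in>E. card {x \<in> {0..<int N}. (T ^^ nat x) e \<in> A}) =
      (\<Sum>e\<in>E. \<Sum>x\<in>{0..<int N}. of_bool ((T ^^ nat x) e \<in> A))"
    by (simp add: Int_def)
  also have "\<dots> = (\<Sum>x\<in>{0..<int N}. \<Sum>e\<in>E. of_bool ((T ^^ nat x) e \<in> A))"
    by (rule sum.swap)
  also have "\<dots> = (\<Sum>x\<in>{0..<int N}. card {e \<in> E. (T ^^ nat x) e \<in> A})"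
    by (simp add: assms(1) Int_def)
  finally show ?thesis by (simp add: A)
qed

text \<open>Every orbit is a one-dimensional grid; a common period of all orbits avoids decomposing
  \<open>E\<close> into orbits.\<close>

lemma orbit_appearances_le:
  assumes "finite E" "T permutes E"
  shows "real (card {e \<in> E. \<forall>i<length w. L ((T ^^ i) e) = w ! i}
      + card {e \<in> E. \<forall>i<length w. L ((inv T ^^ i) e) = w ! i}) \<le> concentration 1 w * real (card E)"
    (is "real (card ?A + card ?B) \<le> _")
proof -
  obtain N where N: "T ^^ N = id" "0 < N"
    using permutation_is_nilpotent assms permutation_permutes by blast
  have inE: "(T ^^ k) e \<in> E" if "e \<in> E" for k e
    using that permutes_in_image[OF permutes_funpow[OF assms(2)]] by blast
  have Tmod: "(T ^^ (k mod N)) e = (T ^^ k) e" for k e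
    by (rule funpow_mod_eq) (simp add: N)
  have inv_T: "(inv T ^^ i) ((T ^^ i) e) = e" for i e
  proof (induction i arbitrary: e)
    case (Suc i)
    have "(inv T ^^ Suc i) ((T ^^ Suc i) e) = (inv T ^^ i) (inv T (T ((T ^^ i) e)))"
      by (simp add: funpow_swap1)
    then show ?case using Suc permutes_inverses(2)[OF assms(2)] by simp
  qed simp
  have fw: "line_hits N (\<lambda>x. L ((T ^^ nat x) e)) w 1 = {x \<in> {0..<int N}. (T ^^ nat x) e \<in> ?A}"
    if "e \<in> E" for e
  proof -
    have "(T ^^ nat ((x + int i * 1) mod int N)) e = (T ^^ i) ((T ^^ nat x) e)" if "0 \<le> x" for x i
    proof -
      have "nat ((x + int i * 1) mod int N) = (i + nat x) mod N"
        using that by (simp add: nat_mod_distrib nat_add_distrib add.commute)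
      then show ?thesis by (simp add: Tmod funpow_add)
    qed
    then show ?thesis using inE[OF that] by (auto simp: line_hits_def)
  qed
  have bw: "line_hits N (\<lambda>x. L ((T ^^ nat x) e)) w (- 1) = {x \<in> {0..<int N}. (T ^^ nat x) e \<in> ?B}"
    if "e \<in> E" for e
  proof -
    have "(T ^^ nat ((x + int i * - 1) mod int N)) e = (inv T ^^ i) ((T ^^ nat x) e)"
      if "x \<in> {0..<int N}" for x i
    proof -
      \<comment> \<open>Going back \<open>i\<close> steps from \<open>x\<close> is described by the
        position \<open>y\<close> from which \<open>i\<close> forward steps lead to
        \<open>x\<close>.\<close>
      define y where "y = (x + int i * - 1) mod int N"
      have "0 \<le> y" using N by (simp add: y_def)
      have "(y + int i) mod int N = x"
        using that by (simp add: y_def mod_simps)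
      then have "x = int ((i + nat y) mod N)"
        using \<open>0 \<le> y\<close> by (simp add: zmod_int add.commute)
      then have "(T ^^ nat x) e = (T ^^ i) ((T ^^ nat y) e)"
        by (simp add: Tmod funpow_add)
      then show ?thesis by (simp add: inv_T y_def)
    qed
    then show ?thesis using inE[OF that] by (auto simp: line_hits_def)
  qed
  \<comment> \<open>Every \<open>e\<close> yields a cyclic word of length \<open>N\<close>; over all
    \<open>e\<close>, each element of the two sets is counted \<open>N\<close> times.\<close>
  have "real N * real (card ?A + card ?B) = real (N * card ?A + N * card ?B)"
    by (simp add: algebra_simps)
  also have "\<dots> = (\<Sum>e\<in>E. real (card (line_hits N (\<lambda>x. L ((T ^^ nat x) e)) w 1)
      + card (line_hits N (\<lambda>x. L ((T ^^ nat x) e)) w (- 1))))"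
    using sum_card_funpow_vimage[OF assms, of ?A N] sum_card_funpow_vimage[OF assms, of ?B N]
    by (simp add: fw bw sum.distrib flip: of_nat_sum)
  also have "\<dots> \<le> (\<Sum>e\<in>E. concentration 1 w * real N)"
    by (intro sum_mono line_hits_le_concentration N(2))
  finally have "real N * real (card ?A + card ?B) \<le> real N * (concentration 1 w * real (card E))"
    by (simp add: algebra_simps)
  then show ?thesis using N(2) by simp
qed

text \<open>\<open>R\<close> preserves the labels and conjugates \<open>R \<circ> F\<close> to its
  inverse, so it matches forward with backward readings. Both kinds are equally many, whence the
  factor 2.\<close>

lemma reflection_appearances_le:
  assumes "finite E" "R permutes E" "F permutes E" "\<And>e. R (R e) = e" "\<And>e. F (F e) = e"
    and "\<And>e. L (R e) = L e"
  shows "2 * real (card {e \<in> E. \<forall>i<length w. L (((R \<circ> F) ^^ i) e) = w ! i})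
    \<le> concentration 1 w * real (card E)"
proof -
  let ?A = "{e \<in> E. \<forall>i<length w. L (((R \<circ> F) ^^ i) e) = w ! i}"
  have perm: "R \<circ> F permutes E" by (rule permutes_compose) fact+
  have inv: "inv (R \<circ> F) = F \<circ> R"
    by (rule inv_unique_comp) (auto simp: fun_eq_iff assms)
  have conj: "((F \<circ> R) ^^ i) e = R (((R \<circ> F) ^^ i) (R e))" for i e
    by (induction i) (auto simp: assms)
  have "{e \<in> E. \<forall>i<length w. L ((inv (R \<circ> F) ^^ i) e) = w ! i} = R ` ?A"
    using permutes_in_image[OF assms(2)] unfolding inv conj
    by (auto simp: assms image_iff) (metis assms(4))
  then have "card {e \<in> E. \<forall>i<length w. L ((inv (R \<circ> F) ^^ i) e) = w ! i} = card ?A"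
    by (simp add: card_image[OF inj_on_subset[OF permutes_inj[OF assms(2)]]])
  then show ?thesis
    using orbit_appearances_le[OF assms(1) perm, of w L] by simp
qed

section \<open>Cuts of the king graph on the torus\<close>

context
  fixes d :: nat and n :: "nat \<Rightarrow> nat"
  assumes n_pos: "\<forall>j<d. 0 < n j"
begin

section \<open>The quadratic form of the box convolution\<close>

abbreviation unit_step :: "int \<Rightarrow> nat \<Rightarrow> nat \<Rightarrow> int" where
  "unit_step s k \<equiv> (\<lambda>j. if j = k then s else 0)"

text \<open>Convolution with the box in the first \<open>k\<close> coordinates, built one axis at a
  time so that its form can be bounded by induction on \<open>k\<close>.\<close>

fun box_sum :: "nat \<Rightarrow> ((nat \<Rightarrow> int) \<Rightarrow> real) \<Rightarrow> (nat \<Rightarrow> int) \<Rightarrow> real" where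
  "box_sum 0 f p = f p"
| "box_sum (Suc k) f p = box_sum k f p + box_sum k f (tadd d n p (unit_step 1 k))
     + box_sum k f (tadd d n p (unit_step (- 1) k))"

lemma box_sum_tadd: "box_sum k (\<lambda>p. f (tadd d n p u)) p = box_sum k f (tadd d n p u)"
  by (induction k arbitrary: p) (simp_all add: tadd_tadd add.commute)

lemma box_sum_add: "box_sum k (\<lambda>p. f p + g p) p = box_sum k f p + box_sum k g p"
  by (induction k arbitrary: p) simp_all

lemma box_sum_diff: "box_sum k (\<lambda>p. f p - g p) p = box_sum k f p - box_sum k g p"
  by (induction k arbitrary: p) simp_all

definition box_form :: "nat \<Rightarrow> ((nat \<Rightarrow> int) \<Rightarrow> real) \<Rightarrow> real" where
  "box_form k f = (\<Sum>p\<in>torus d n. f p * box_sum k f p)"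

definition sq_norm :: "((nat \<Rightarrow> int) \<Rightarrow> real) \<Rightarrow> real" where
  "sq_norm f = (\<Sum>p\<in>torus d n. (f p)\<^sup>2)"

text \<open>Polarisation in place of Fourier analysis: this is 1 + 2 cos t = 3 cos^2(t/2) -
  sin^2(t/2) for the shift along axis \<open>k\<close>, where the sum \<open>f + g\<close> carries
  the cosine and the difference \<open>f - g\<close> the sine.\<close>

lemma box_form_Suc:
  fixes f k
  defines "g \<equiv> \<lambda>p. f (tadd d n p (unit_step 1 k))"
  shows "4 * box_form (Suc k) f = 3 * box_form k (\<lambda>p. f p + g p) - box_form k (\<lambda>p. f p - g p)"
    and "4 * sq_norm f = sq_norm (\<lambda>p. f p + g p) + sq_norm (\<lambda>p. f p - g p)"
proof -
  let ?T = "torus d n" and ?u = "unit_step 1 k" and ?B = "box_sum k f"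
  define X where "X = (\<Sum>p\<in>?T. f p * ?B (tadd d n p ?u))"
  define Y where "Y = (\<Sum>p\<in>?T. f (tadd d n p ?u) * ?B p)"
  have g: "box_sum k g p = ?B (tadd d n p ?u)" for p
    unfolding g_def by (rule box_sum_tadd)
  have gg: "(\<Sum>p\<in>?T. f (tadd d n p ?u) * ?B (tadd d n p ?u)) = box_form k f"
    unfolding box_form_def by (rule sum_tadd[OF n_pos])
  have Y': "(\<Sum>p\<in>?T. f p * ?B (tadd d n p (unit_step (- 1) k))) = Y"
  proof -
    have "Y = (\<Sum>p\<in>?T. f (tadd d n p ?u) * ?B (tadd d n (tadd d n p ?u) (unit_step (- 1) k)))"
      unfolding Y_def
    proof (rule sum.cong[OF refl])
      fix p assume "p \<in> ?T"
      then have "tadd d n (tadd d n p ?u) (unit_step (- 1) k) = p"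
        by (auto simp: tadd_tadd intro!: tadd_zero)
      then show "f (tadd d n p ?u) * ?B p = f (tadd d n p ?u) * ?B (tadd d n (tadd d n p ?u) (unit_step (- 1) k))"
        by simp
    qed
    then show ?thesis
      using sum_tadd[OF n_pos, of "\<lambda>p. f p * ?B (tadd d n p (unit_step (- 1) k))" ?u] by simp
  qed
  have plus: "box_form k (\<lambda>p. f p + g p) = 2 * box_form k f + X + Y"
    unfolding box_form_def box_sum_add g
    using gg by (simp add: g_def algebra_simps sum.distrib X_def Y_def box_form_def)
  have minus: "box_form k (\<lambda>p. f p - g p) = 2 * box_form k f - X - Y"
    unfolding box_form_def box_sum_diff g
    using gg by (simp add: g_def algebra_simps sum.distrib sum_subtractf X_def Y_def box_form_def)
  have "box_form (Suc k) f = box_form k f + X + Y"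
    using Y' by (simp add: box_form_def algebra_simps sum.distrib X_def)
  then show "4 * box_form (Suc k) f = 3 * box_form k (\<lambda>p. f p + g p) - box_form k (\<lambda>p. f p - g p)"
    using plus minus by simp
  have "sq_norm g = sq_norm f"
    unfolding sq_norm_def g_def by (rule sum_tadd[OF n_pos])
  then show "4 * sq_norm f = sq_norm (\<lambda>p. f p + g p) + sq_norm (\<lambda>p. f p - g p)"
    by (simp add: sq_norm_def power2_sum power2_diff sum.distrib sum_subtractf)
qed

lemma sq_norm_nonneg: "0 \<le> sq_norm f"
  by (simp add: sq_norm_def sum_nonneg)

text \<open>Each axis contributes a factor with spectrum in [-1, 3], and a negative product has at
  least one factor of modulus at most 1. The two bounds go through the induction together because
  the form of the difference enters with a minus sign.\<close>

lemma box_form_bounds: "- (3 ^ k / 3) * sq_norm f \<le> box_form k f \<and> box_form k f \<le> 3 ^ k * sq_norm f"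
proof (induction k arbitrary: f)
  case 0
  then show ?case
    using sq_norm_nonneg[of f] by (simp add: box_form_def sq_norm_def power2_eq_square)
next
  case (Suc k)
  let ?P = "\<lambda>p. f p + f (tadd d n p (unit_step 1 k))" and ?M = "\<lambda>p. f p - f (tadd d n p (unit_step 1 k))"
  \<comment> \<open>For the upper bound: there \<open>?M\<close> arrives with coefficient
    \<open>3 ^ k / 3\<close>, below the available \<open>3 * 3 ^ k\<close>.\<close>
  have "0 \<le> 3 ^ k * sq_norm ?M" using sq_norm_nonneg by simp
  moreover have "3 ^ Suc k * (4 * sq_norm f) = 3 * (3 ^ k * sq_norm ?P) + 3 * (3 ^ k * sq_norm ?M)"
    unfolding box_form_Suc(2)[of f k] by (simp add: algebra_simps)
  ultimately show ?case
    using Suc[of ?P] Suc[of ?M] box_form_Suc(1)[of k f] by simp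
qed

lemma box_sum_eq_sum:
  assumes "k \<le> d" "p \<in> torus d n"
  shows "box_sum k f p =
    (\<Sum>v\<in>(\<Pi>\<^sub>E i\<in>{..<k}. {-1, 0, 1}). f (tadd d n p (\<lambda>j. if j < k then v j else 0)))"
  using assms
proof (induction k arbitrary: p)
  case 0
  then show ?case by (simp add: tadd_zero)
next
  case (Suc k)
  let ?P = "\<Pi>\<^sub>E i\<in>{..<k}. {-1, 0, 1 :: int}"
  have step: "box_sum k f (tadd d n p (unit_step s k)) =
      (\<Sum>v\<in>?P. f (tadd d n p (\<lambda>j. if j < Suc k then (v(k := s)) j else 0)))" for s
  proof -
    have "tadd d n (tadd d n p (unit_step s k)) (\<lambda>j. if j < k then v j else 0)
        = tadd d n p (\<lambda>j. if j < Suc k then (v(k := s)) j else 0)" for v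
      unfolding tadd_tadd by (rule tadd_cong) auto
    then show ?thesis using Suc by (simp add: tadd_in_torus n_pos)
  qed
  define F where "F v = f (tadd d n p (\<lambda>j. if j < Suc k then v j else 0))" for v
  have inj: "inj_on (\<lambda>(y, g). g(k := y)) ({-1, 0, 1} \<times> ?P)"
    by (rule inj_combinator) simp
  have set: "(\<Pi>\<^sub>E i\<in>{..<Suc k}. {-1, 0, 1}) = (\<lambda>(y, g). g(k := y)) ` ({-1, 0, 1} \<times> ?P)"
    unfolding lessThan_Suc by (rule PiE_insert_eq)
  have "(\<Sum>v\<in>(\<Pi>\<^sub>E i\<in>{..<Suc k}. {-1, 0, 1}). F v) = (\<Sum>s\<in>{-1, 0, 1}. \<Sum>v\<in>?P. F (v(k := s)))"
    unfolding set sum.reindex[OF inj] sum.cartesian_product by (simp add: o_def case_prod_unfold)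
  also have "\<dots> = (\<Sum>s\<in>{-1, 0, 1}. box_sum k f (tadd d n p (unit_step s k)))"
    by (simp only: step F_def)
  also have "\<dots> = box_sum (Suc k) f p"
    using tadd_zero[OF Suc.prems(2), of "unit_step 0 k"] by simp
  finally show ?case by (simp add: F_def)
qed

text \<open>With \<open>f = \<plusminus>1\<close> the number of cut edges is an affine function of the form
  \<open>\<Sum>p. \<Sum>v. f p * f (p + v)\<close>, whose least value is attained by stripes.\<close>

lemma card_cut_le:
  fixes c :: "(nat \<Rightarrow> int) \<Rightarrow> bool"
  assumes "d \<ge> 1"
  shows "card {(p, v) \<in> torus d n \<times> directions d. c p \<noteq> c (tadd d n p v)} \<le> 2 * 3 ^ (d - 1) * card (torus d n)"
proof -
  define f where "f p = (if c p then 1 else -1 :: real)" for p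
  let ?T = "torus d n" and ?V = "\<Pi>\<^sub>E i\<in>{..<d}. {-1, 0, 1 :: int}"
  \<comment> \<open>These are directed edges: every cut edge occurs once from each end.\<close>
  let ?C = "{(p, v) \<in> ?T \<times> directions d. c p \<noteq> c (tadd d n p v)}"
  have "(f p)\<^sup>2 = 1" for p by (simp add: f_def)
  then have norm: "sq_norm f = real (card ?T)" by (simp add: sq_norm_def)
  \<comment> \<open>The zero vector can join the directions since it never crosses the cut.\<close>
  have "?C = (SIGMA p:?T. {v \<in> ?V. c p \<noteq> c (tadd d n p v)})"
  proof -
    have "c (tadd d n p (\<lambda>i\<in>{..<d}. 0)) = c p" if "p \<in> ?T" for p
      by (subst tadd_zero[OF that]) auto
    then show ?thesis by (auto simp: directions_def)
  qed
  then have C: "real (card ?C) = (\<Sum>p\<in>?T. \<Sum>v\<in>?V. of_bool (c p \<noteq> c (tadd d n p v)))"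
    by (simp add: card_SigmaI finite_torus finite_PiE Int_def)
  have box: "box_sum d f p = (\<Sum>v\<in>?V. f (tadd d n p v))" if "p \<in> ?T" for p
    unfolding box_sum_eq_sum[OF order_refl that]
    by (intro sum.cong refl arg_cong[where f = f] tadd_cong) auto
  \<comment> \<open>The product of two values of \<open>f\<close> is -1 across the cut and 1
    otherwise.\<close>
  have "box_form d f = (\<Sum>p\<in>?T. \<Sum>v\<in>?V. 1 - 2 * of_bool (c p \<noteq> c (tadd d n p v)))"
    unfolding box_form_def
  proof (rule sum.cong[OF refl])
    fix p assume "p \<in> ?T"
    then show "f p * box_sum d f p = (\<Sum>v\<in>?V. 1 - 2 * of_bool (c p \<noteq> c (tadd d n p v)))"
      unfolding box[OF \<open>p \<in> ?T\<close>] sum_distrib_left by (intro sum.cong refl) (simp add: f_def)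
  qed
  also have "\<dots> = 3 ^ d * real (card ?T) - 2 * real (card ?C)"
    unfolding C sum_subtractf sum_distrib_left[symmetric]
    by (simp add: card_PiE numeral_3_eq_3 del: sum_of_bool_eq)
  finally have "- (3 ^ d / 3) * real (card ?T) \<le> 3 ^ d * real (card ?T) - 2 * real (card ?C)"
    using box_form_bounds[of d f] norm by simp
  moreover have "(3::real) ^ d = 3 * 3 ^ (d - 1)"
    using assms by (simp add: power_eq_if)
  ultimately have "real (card ?C) \<le> real (2 * 3 ^ (d - 1) * card ?T)"
    by (simp add: algebra_simps)
  then show ?thesis by (simp only: of_nat_le_iff)
qed

end

section \<open>Words whose letters determine the parity of the index\<close>

lemma involution_permutes:
  assumes "\<And>x. x \<notin> E \<Longrightarrow> f x = x" "\<And>x. f (f x) = x"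
  shows "f permutes E"
  unfolding permutes_def using assms by metis

lemma is_word_length: "is_word w \<Longrightarrow> 2 \<le> length w"
proof (rule ccontr)
  assume "is_word w" "\<not> 2 \<le> length w"
  then show False by (cases w rule: remdups_adj.cases) (auto simp: is_word_def)
qed

text \<open>An appearance only traverses edges joining an odd letter to an even one. Reflecting at the
  other edges turns each line into a family of closed walks on the cut edges, so the
  one-dimensional bound applies with the number of cut edges in place of the size of the grid.\<close>

lemma stackable_if_parity_separated:
  fixes w :: "'a list"
  assumes w: "is_word w"
    and par: "\<And>i j. i < length w \<Longrightarrow> j < length w \<Longrightarrow> odd i \<Longrightarrow> even j \<Longrightarrow> w ! i \<noteq> w ! j"
    and d: "d \<ge> 1"
  shows "stackable d w"
proof -
  have "concentration d w \<le> 3 ^ (d - 1) * concentration 1 w"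
  proof (rule concentration_leI)
    fix n :: "nat \<Rightarrow> nat" and \<Gamma> :: "(nat \<Rightarrow> int) \<Rightarrow> 'a" assume n: "\<forall>i<d. 0 < n i"
    \<comment> \<open>The cut separates letters of odd index from all others, so consecutive cells
      of an appearance lie on opposite sides.\<close>
    define c where "c p \<longleftrightarrow> (\<exists>i<length w. odd i \<and> w ! i = \<Gamma> p)" for p
    define E where "E = {(p, v) \<in> torus d n \<times> directions d. c p \<noteq> c (tadd d n p v)}"
    \<comment> \<open>A pair in \<open>E\<close> is a cut edge directed away from its tail.
      \<open>F\<close> crosses it; then \<open>R\<close> goes straight on if the next edge is cut
      and turns back otherwise. So \<open>R \<circ> F\<close> follows a line with
      reflections.\<close>
    define R where "R = (\<lambda>(p, v). if (p, v) \<in> E \<and> (p, neg_dir d v) \<in> E then (p, neg_dir d v) else (p, v))"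
    define F where "F = (\<lambda>(p, v). if (p, v) \<in> E then (tadd d n p v, neg_dir d v) else (p, v))"
    define L :: "(nat \<Rightarrow> int) \<times> (nat \<Rightarrow> int) \<Rightarrow> 'a" where "L = (\<lambda>e. \<Gamma> (fst e))"
    have finE: "finite E"
      by (rule finite_subset[of _ "torus d n \<times> directions d"]) (auto simp: E_def finite_torus finite_directions)
    have undo_step: "tadd d n (tadd d n p v) (neg_dir d v) = p" if "p \<in> torus d n" for p v
      unfolding tadd_tadd by (rule tadd_zero[OF that]) (simp add: neg_dir_apply)
    have RR: "R (R e) = e" for e
      by (cases e) (auto simp: R_def E_def neg_dir_neg_dir)
    have flip: "(tadd d n p v, neg_dir d v) \<in> E" if "(p, v) \<in> E" for p v
      using that by (auto simp: E_def undo_step tadd_in_torus[OF n] neg_dir_in_directions)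
    have FF: "F (F e) = e" for e
      using flip by (cases e) (auto simp: F_def E_def undo_step neg_dir_neg_dir)
    have permR: "R permutes E" by (rule involution_permutes[OF _ RR]) (auto simp: R_def)
    have permF: "F permutes E" by (rule involution_permutes[OF _ FF]) (auto simp: F_def)
    have LR: "L (R e) = L e" for e by (cases e) (simp add: L_def R_def)
    have app: "appearances d n \<Gamma> w \<subseteq> {e \<in> E. \<forall>i<length w. L (((R \<circ> F) ^^ i) e) = w ! i}"
    proof
      fix e assume e: "e \<in> appearances d n \<Gamma> w"
      obtain p v where pv: "e = (p, v)" by (cases e)
      let ?q = "\<lambda>i. tadd d n p (\<lambda>j. int i * v j)"
      have p: "p \<in> torus d n" and v: "v \<in> directions d"
        and hit: "\<And>i. i < length w \<Longrightarrow> \<Gamma> (?q i) = w ! i"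
        using e by (auto simp: pv mem_appearances)
      have q0: "?q 0 = p" by (rule tadd_zero[OF p]) simp
      have qS: "tadd d n (?q i) v = ?q (Suc i)" for i
        unfolding tadd_tadd by (rule tadd_cong) (simp add: algebra_simps)
      have c: "c (?q i) \<longleftrightarrow> odd i" if "i < length w" for i
        using hit[OF that] par that unfolding c_def by metis
      have inE: "(?q i, v) \<in> E" if "Suc i < length w" for i
        using c[of i] c[of "Suc i"] that v by (simp add: E_def qS tadd_in_torus[OF n])
      \<comment> \<open>After the last letter the next edge may be uncut and the walk may turn, so
        there only the cell is claimed.\<close>
      have step: "fst (((R \<circ> F) ^^ i) e) = ?q i \<and> (Suc i < length w \<longrightarrow> ((R \<circ> F) ^^ i) e = (?q i, v))"
        if "i < length w" for i
        using that
      proof (induction i)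
        case 0
        then show ?case using q0 by (simp add: pv)
      next
        case (Suc i)
        then have "((R \<circ> F) ^^ Suc i) e = R (F (?q i, v))"
          by (metis Suc_lessD comp_apply funpow.simps(2))
        also have "\<dots> = R (?q (Suc i), neg_dir d v)"
          using inE[of i] Suc.prems by (simp add: F_def qS)
        finally have *: "((R \<circ> F) ^^ Suc i) e = R (?q (Suc i), neg_dir d v)" .
        have "(?q (Suc i), neg_dir d v) \<in> E"
          using flip[OF inE[of i]] Suc.prems by (simp add: qS)
        then show ?case
          unfolding * using inE[of "Suc i"] by (auto simp: R_def neg_dir_neg_dir[OF v])
      qed
      have "(p, v) \<in> E" using inE[of 0] is_word_length[OF w] q0 by simp
      then show "e \<in> {e \<in> E. \<forall>i<length w. L (((R \<circ> F) ^^ i) e) = w ! i}"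
        using step hit by (auto simp: L_def pv)
    qed
    \<comment> \<open>The factor 2 from reading both ways cancels the one from counting each cut
      edge at both ends.\<close>
    have "2 * real (card (appearances d n \<Gamma> w)) \<le>
        2 * real (card {e \<in> E. \<forall>i<length w. L (((R \<circ> F) ^^ i) e) = w ! i})"
      using app finE by (simp add: card_mono)
    also have "\<dots> \<le> concentration 1 w * real (card E)"
      by (rule reflection_appearances_le) (fact finE permR permF RR FF LR)+
    also have "\<dots> \<le> concentration 1 w * real (2 * 3 ^ (d - 1) * card (torus d n))"
      using card_cut_le[OF n d, of c] concentration_nonneg
      by (intro mult_left_mono) (simp_all only: E_def of_nat_le_iff)
    finally show "real (card (appearances d n \<Gamma> w)) \<le>
        3 ^ (d - 1) * concentration 1 w * real (card (torus d n))"
      by (simp add: algebra_simps)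
  qed
  then show ?thesis using stackable_iff_le[OF d] by blast
qed

section \<open>Repeating letters\<close>

lemma length_repeat_letters: "length (repeat_letters k w) = k * length w"
  by (induction w) (auto simp: repeat_letters_def)

lemma nth_repeat_letters:
  assumes "i < k * length w"
  shows "repeat_letters k w ! i = w ! (i div k)"
  using assms
proof (induction w arbitrary: i)
  case (Cons a w)
  have eq: "repeat_letters k (a # w) = replicate k a @ repeat_letters k w"
    by (simp add: repeat_letters_def)
  show ?case
  proof (cases "i < k")
    case True
    then show ?thesis by (simp add: eq nth_append)
  next
    case False
    then have "i div k = Suc ((i - k) div k)" using Cons.prems
      by (intro le_div_geq) (auto intro: gr0I)
    then show ?thesis using False Cons by (simp add: eq nth_append)
  qed
qed simp

lemma not_is_word_constant:
  assumes "\<And>r. Suc r < length w \<Longrightarrow> w ! r = w ! Suc r"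
  shows "\<not> is_word w"
proof -
  have "w ! r = w ! 0" if "r < length w" for r
    using that by (induction r) (use assms in \<open>auto dest: Suc_lessD\<close>)
  then show ?thesis by (metis in_set_conv_nth is_word_def)
qed

text \<open>The index \<open>\<delta>\<close> before the end of a block lies in that block and is
  shifted to the start of the next, so a period \<open>\<delta>\<close> would make neighbouring
  letters of \<open>w\<close> equal.\<close>

lemma repeat_letters_not_periodic:
  assumes "is_word w" "0 < \<delta>" "\<delta> < k"
  shows "\<exists>i. i + \<delta> < k * length w \<and> repeat_letters k w ! i \<noteq> repeat_letters k w ! (i + \<delta>)"
proof (rule ccontr)
  assume "\<not> ?thesis"
  then have per: "repeat_letters k w ! i = repeat_letters k w ! (i + \<delta>)" if "i + \<delta> < k * length w" for i
    using that by blast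
  have "w ! r = w ! Suc r" if r: "Suc r < length w" for r
  proof -
    have lt: "k * Suc r < k * length w" using r assms by (intro mult_strict_left_mono) auto
    have "(k * r + (k - \<delta>)) + \<delta> = k * Suc r" using assms by simp
    moreover have "(k * r + (k - \<delta>)) div k = r"
      by (rule div_nat_eqI) (use assms in auto)
    moreover have "k * r + (k - \<delta>) < k * length w"
      by (rule le_less_trans[OF _ lt]) simp
    ultimately show ?thesis
      using per[of "k * r + (k - \<delta>)"] lt assms
      by (metis nth_repeat_letters nonzero_mult_div_cancel_left not_less_zero)
  qed
  then show False using not_is_word_constant assms(1) by blast
qed

text \<open>For every base cell \<open>q\<close> the cells reached by \<open>k\<close>-fold
  displacements form a grid \<open>G q\<close> of the same shape. For fixed \<open>x\<close> the
  shift by \<open>k\<close> times \<open>x\<close> permutes the base cells, so summing over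
  \<open>q\<close> counts every spaced appearance once per \<open>x\<close>, whether or not
  multiplication by \<open>k\<close> is injective on the torus.\<close>

lemma card_spaced_appearances_le:
  fixes w :: "'a list" and k :: nat
  assumes n: "\<forall>i<d. 0 < n i"
  shows "real (card {(p, v) \<in> torus d n \<times> directions d.
      \<forall>i<length w. \<Gamma> (tadd d n p (\<lambda>j. int (k * i) * v j)) = w ! i})
    \<le> concentration d w * real (card (torus d n))"
proof -
  define Q where "Q p v \<longleftrightarrow> (\<forall>i<length w. \<Gamma> (tadd d n p (\<lambda>j. int (k * i) * v j)) = w ! i)" for p v
  let ?T = "torus d n" and ?D = "directions d"
  have "{(p, v) \<in> ?T \<times> ?D. Q p v} = (SIGMA p:?T. {v \<in> ?D. Q p v})" by auto
  then have M: "card {(p, v) \<in> ?T \<times> ?D. Q p v} = (\<Sum>p\<in>?T. \<Sum>v\<in>?D. of_bool (Q p v))"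
    by (simp add: card_SigmaI finite_torus finite_directions Int_def)
  define G where "G q = (\<lambda>x. \<Gamma> (tadd d n q (\<lambda>j. int k * x j)))" for q
  have shift: "(\<forall>i<length w. G q (tadd d n x (\<lambda>j. int i * v j)) = w ! i) \<longleftrightarrow> Q (tadd d n q (\<lambda>j. int k * x j)) v"
    for q x v
  proof -
    have "tadd d n q (\<lambda>j. int k * tadd d n x (\<lambda>j. int i * v j) j)
        = tadd d n (tadd d n q (\<lambda>j. int k * x j)) (\<lambda>j. int (k * i) * v j)" for i
    proof -
      have "(q j + int k * ((x j + int i * v j) mod int (n j))) mod int (n j)
          = (q j + int k * (x j + int i * v j)) mod int (n j)" for j
        by (metis mod_add_right_eq mod_mult_right_eq)
      then show ?thesis
        unfolding tadd_tadd unfolding tadd_def by (intro restrict_ext) (simp add: algebra_simps)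
    qed
    then show ?thesis by (simp add: G_def Q_def)
  qed
  have "(\<Sum>q\<in>?T. card (appearances d n (G q) w)) =
      (\<Sum>q\<in>?T. \<Sum>x\<in>?T. \<Sum>v\<in>?D. of_bool (Q (tadd d n q (\<lambda>j. int k * x j)) v))"
    unfolding card_appearances_sum shift ..
  also have "\<dots> = (\<Sum>x\<in>?T. \<Sum>q\<in>?T. \<Sum>v\<in>?D. of_bool (Q (tadd d n q (\<lambda>j. int k * x j)) v))"
    by (rule sum.swap)
  also have "\<dots> = (\<Sum>x\<in>?T. card {(p, v) \<in> ?T \<times> ?D. Q p v})"
    unfolding M by (rule sum.cong[OF refl]) (rule sum_tadd[OF n])
  finally have "real (card ?T) * real (card {(p, v) \<in> ?T \<times> ?D. Q p v})
      = (\<Sum>q\<in>?T. real (card (appearances d n (G q) w)))"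
    by (simp flip: of_nat_sum of_nat_mult)
  also have "\<dots> \<le> (\<Sum>q\<in>?T. concentration d w * real (card ?T))"
    by (intro sum_mono appearances_le_concentration n)
  finally have "real (card ?T) * real (card {(p, v) \<in> ?T \<times> ?D. Q p v})
      \<le> real (card ?T) * (concentration d w * real (card ?T))" by simp
  then show ?thesis using card_torus_pos[OF n] by (simp add: Q_def)
qed

text \<open>From each of the first \<open>k\<close> cells of an appearance, \<open>w\<close> is read
  with spacing \<open>k\<close>. If two appearances in one direction shared such a reading at
  different offsets, the stretched word would have a period below \<open>k\<close>.\<close>

lemma concentration_repeat_letters_le:
  fixes w :: "'a list"
  assumes w: "is_word w" and k: "k \<ge> 1"
  shows "concentration d (repeat_letters k w) \<le> concentration d w / real k"
proof (rule concentration_leI)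
  fix n :: "nat \<Rightarrow> nat" and \<Gamma> :: "(nat \<Rightarrow> int) \<Rightarrow> 'a" assume n: "\<forall>i<d. 0 < n i"
  let ?A = "appearances d n \<Gamma> (repeat_letters k w)"
  let ?M = "{(p, v) \<in> torus d n \<times> directions d.
      \<forall>i<length w. \<Gamma> (tadd d n p (\<lambda>j. int (k * i) * v j)) = w ! i}"
  define f where "f = (\<lambda>((p, v), s :: nat). (tadd d n p (\<lambda>j. int s * v j), v :: nat \<Rightarrow> int))"
  have inj_aux: False
    if A: "(p, v) \<in> ?A" "(p', v) \<in> ?A" and st: "s < t" "t < k"
      and eq: "tadd d n p (\<lambda>j. int s * v j) = tadd d n p' (\<lambda>j. int t * v j)" for p p' v s t
  proof -
    define \<delta> where "\<delta> = t - s"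
    have \<delta>: "0 < \<delta>" "\<delta> < k" using st by (auto simp: \<delta>_def)
    have "tadd d n p (\<lambda>j. int i * v j) = tadd d n p' (\<lambda>j. int (i + \<delta>) * v j)" for i
    proof -
      have "tadd d n p (\<lambda>j. int i * v j) = tadd d n (tadd d n p (\<lambda>j. int s * v j)) (\<lambda>j. (int i - int s) * v j)"
        unfolding tadd_tadd by (rule tadd_cong) (simp add: algebra_simps)
      also have "\<dots> = tadd d n p' (\<lambda>j. int (i + \<delta>) * v j)"
        unfolding eq tadd_tadd by (rule tadd_cong) (use st in \<open>simp add: algebra_simps \<delta>_def of_nat_diff\<close>)
      finally show ?thesis .
    qed
    then have "repeat_letters k w ! i = repeat_letters k w ! (i + \<delta>)" if "i + \<delta> < k * length w" for i
      using A that unfolding mem_appearances length_repeat_letters by (metis add_lessD1)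
    then show False using repeat_letters_not_periodic[OF w \<delta>] by blast
  qed
  have inj: "inj_on f (?A \<times> {..<k})"
  proof (rule inj_onI)
    fix x y assume xy: "x \<in> ?A \<times> {..<k}" "y \<in> ?A \<times> {..<k}" "f x = f y"
    obtain p v s p' v' t where x: "x = ((p, v), s)" and y: "y = ((p', v'), t)" by (metis surj_pair)
    have v': "v' = v" and eq: "tadd d n p (\<lambda>j. int s * v j) = tadd d n p' (\<lambda>j. int t * v j)"
      using xy by (auto simp: x y f_def)
    have A: "(p, v) \<in> ?A" "(p', v) \<in> ?A" "s < k" "t < k" using xy by (auto simp: x y v')
    have "s = t" using inj_aux[OF A(1,2)] inj_aux[OF A(2,1)] A(3,4) eq by (metis linorder_neqE_nat)
    have "p \<in> torus d n" "p' \<in> torus d n" using A by (auto simp: mem_appearances)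
    then have "p = p'" using eq tadd_tadd_minus[OF n] unfolding \<open>s = t\<close> by metis
    then show "x = y" using \<open>s = t\<close> by (simp add: x y v')
  qed
  have img: "f ` (?A \<times> {..<k}) \<subseteq> ?M"
  proof
    fix y assume "y \<in> f ` (?A \<times> {..<k})"
    then obtain p v s where y: "y = f ((p, v), s)" and A: "(p, v) \<in> ?A" and s: "s < k" by auto
    have "\<Gamma> (tadd d n (tadd d n p (\<lambda>j. int s * v j)) (\<lambda>j. int (k * i) * v j)) = w ! i" if i: "i < length w" for i
    proof -
      have "tadd d n (tadd d n p (\<lambda>j. int s * v j)) (\<lambda>j. int (k * i) * v j) = tadd d n p (\<lambda>j. int (s + k * i) * v j)"
        unfolding tadd_tadd by (rule tadd_cong) (simp add: algebra_simps)
      moreover have "s + k * i < k * length w"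
      proof -
        have "s + k * i < k * Suc i" using s by simp
        also have "\<dots> \<le> k * length w" using i by (intro mult_le_mono2) simp
        finally show ?thesis .
      qed
      moreover have "(s + k * i) div k = i" using s by simp
      ultimately show ?thesis
        using A by (auto simp: mem_appearances length_repeat_letters nth_repeat_letters)
    qed
    then show "y \<in> ?M" using A by (auto simp: y f_def mem_appearances tadd_in_torus[OF n])
  qed
  have finM: "finite ?M"
    by (rule finite_subset[of _ "torus d n \<times> directions d"]) (auto simp: finite_torus finite_directions)
  have "card ?A * k = card (?A \<times> {..<k})" by (simp add: card_cartesian_product)
  also have "\<dots> \<le> card ?M" by (rule card_inj_on_le[OF inj img finM])
  finally have "real (card ?A) * real k \<le> real (card ?M)" by (simp flip: of_nat_mult)
  also have "\<dots> \<le> concentration d w * real (card (torus d n))"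
    by (rule card_spaced_appearances_le[OF n])
  finally show "real (card ?A) \<le> concentration d w / real k * real (card (torus d n))"
    using k by (simp add: field_simps)
qed

text \<open>Stretching a cyclic word keeps all its hits while its length grows by the factor
  \<open>k\<close>.\<close>

lemma concentration_1_le_repeat_letters:
  fixes w :: "'a list"
  assumes k: "k \<ge> 1"
  shows "concentration 1 w \<le> real k * concentration 1 (repeat_letters k w)"
proof (rule concentration_1_leI)
  fix m :: nat and h :: "int \<Rightarrow> 'a" assume m: "0 < m"
  let ?h = "\<lambda>x. h (x div int k)" and ?w = "repeat_letters k w"
  have k0: "0 < int k" using k by simp
  have div_mod: "(a mod int (k * m)) div int k = (a div int k) mod int m" for a
    using k0 m by (simp add: zmod_zmult2_eq)
  have fw: "card (line_hits m h w 1) \<le> card (line_hits (k * m) ?h ?w 1)"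
  proof (rule card_inj_on_le[OF _ _ finite_line_hits])
    show "inj_on (\<lambda>x. int k * x) (line_hits m h w 1)" using k by (auto simp: inj_on_def)
    show "(\<lambda>x. int k * x) ` line_hits m h w 1 \<subseteq> line_hits (k * m) ?h ?w 1"
    proof (rule image_subsetI)
      fix x assume x: "x \<in> line_hits m h w 1"
      have "?h ((int k * x + int i * 1) mod int (k * m)) = ?w ! i" if i: "i < k * length w" for i
      proof -
        have "(int k * x + int i * 1) div int k = x + int (i div k) * 1"
          using k0 by (simp add: zdiv_int)
        moreover have "i div k < length w" using i k by (simp add: less_mult_imp_div_less mult.commute)
        ultimately show ?thesis using x i unfolding div_mod by (simp add: line_hits_def nth_repeat_letters)
      qed
      then show "int k * x \<in> line_hits (k * m) ?h ?w 1"
        using x k0 by (auto simp: line_hits_def length_repeat_letters)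
    qed
  qed
  have bw: "card (line_hits m h w (- 1)) \<le> card (line_hits (k * m) ?h ?w (- 1))"
  proof (rule card_inj_on_le[OF _ _ finite_line_hits])
    \<comment> \<open>Read backwards, the stretched word starts at the last cell of the block of
      \<open>x\<close>.\<close>
    show "inj_on (\<lambda>x. int k * x + (int k - 1)) (line_hits m h w (- 1))" using k by (auto simp: inj_on_def)
    show "(\<lambda>x. int k * x + (int k - 1)) ` line_hits m h w (- 1) \<subseteq> line_hits (k * m) ?h ?w (- 1)"
    proof (rule image_subsetI)
      fix x assume x: "x \<in> line_hits m h w (- 1)"
      have "?h ((int k * x + (int k - 1) + int i * - 1) mod int (k * m)) = ?w ! i" if i: "i < k * length w" for i
      proof -
        have "int i = int k * int (i div k) + int (i mod k)"
          by (metis mult_div_mod_eq of_nat_add of_nat_mult)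
        then have "int k * x + (int k - 1) + int i * - 1
            = int k * (x - int (i div k)) + (int k - 1 - int (i mod k))"
          by (simp add: algebra_simps)
        moreover have "0 \<le> int k - 1 - int (i mod k)" "int k - 1 - int (i mod k) < int k"
          using k mod_less_divisor[of k i] by linarith+
        ultimately have "(int k * x + (int k - 1) + int i * - 1) div int k = x - int (i div k)"
          by (rule int_div_pos_eq)
        moreover have "i div k < length w" using i k by (simp add: less_mult_imp_div_less mult.commute)
        ultimately show ?thesis using x i unfolding div_mod by (simp add: line_hits_def nth_repeat_letters)
      qed
      moreover have "int k * x + (int k - 1) < int (k * m)"
      proof -
        have "int k * (x + 1) \<le> int k * int m"
          using x k0 by (intro mult_left_mono) (auto simp: line_hits_def)
        then show ?thesis by (simp add: algebra_simps)
      qed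
      ultimately show "int k * x + (int k - 1) \<in> line_hits (k * m) ?h ?w (- 1)"
        using x k0 by (auto simp: line_hits_def length_repeat_letters)
    qed
  qed
  have "real (card (line_hits m h w 1) + card (line_hits m h w (- 1))) \<le>
      real (card (line_hits (k * m) ?h ?w 1) + card (line_hits (k * m) ?h ?w (- 1)))"
    using fw bw by linarith
  also have "\<dots> \<le> concentration 1 ?w * real (k * m)"
    by (rule line_hits_le_concentration) (use k m in simp)
  finally show "real (card (line_hits m h w 1) + card (line_hits m h w (- 1)))
      \<le> real k * concentration 1 ?w * real m"
    by (simp add: algebra_simps)
qed

lemma stackable_repeat_letters:
  assumes "is_word w" "d \<ge> 1" "k \<ge> 1" "stackable d w"
  shows "stackable d (repeat_letters k w)"
proof -
  have "concentration d (repeat_letters k w) \<le> concentration d w / real k"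
    by (rule concentration_repeat_letters_le) fact+
  also have "\<dots> = 3 ^ (d - 1) * concentration 1 w / real k"
    using assms(4) by (simp add: stackable_def)
  also have "\<dots> \<le> 3 ^ (d - 1) * concentration 1 (repeat_letters k w)"
    using concentration_1_le_repeat_letters[OF assms(3), of w] assms(3) by (simp add: field_simps)
  finally show ?thesis using stackable_iff_le[OF assms(2)] by blast
qed

section \<open>Windows in two-dimensional grids\<close>

definition dvec :: "int \<Rightarrow> int \<Rightarrow> nat \<Rightarrow> int" where
  "dvec a b = (\<lambda>j\<in>{..<2}. if j = 0 then a else b)"

lemma dvec_apply: "dvec a b 0 = a" "dvec a b (Suc 0) = b"
  by (simp_all add: dvec_def)

lemma dvec_eq_iff: "dvec a b = dvec a' b' \<longleftrightarrow> a = a' \<and> b = b'"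
  by (metis dvec_apply)

lemma directions_2:
  "directions 2 = {dvec (- 1) (- 1), dvec (- 1) 0, dvec (- 1) 1, dvec 0 1,
     dvec 1 1, dvec 1 0, dvec 1 (- 1), dvec 0 (- 1)}" (is "_ = ?D")
proof
  show "directions 2 \<subseteq> ?D"
  proof
    fix v assume v: "v \<in> directions 2"
    then have "v = dvec (v 0) (v 1)"
      by (auto simp: directions_def PiE_iff extensional_def dvec_def fun_eq_iff less_2_cases_iff)
    moreover have "v 0 \<in> {-1, 0, 1}" "v 1 \<in> {-1, 0, 1}"
      using v by (auto simp: directions_def PiE_iff)
    moreover have "dvec 0 0 = (\<lambda>i\<in>{..<2}. 0)" by (simp add: dvec_def)
    then have "dvec 0 0 \<notin> directions 2" by (simp add: directions_def)
    ultimately show "v \<in> ?D" using v by (metis insert_iff singletonD)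
  qed
  have "dvec a b \<in> directions 2" if "a \<in> {-1, 0, 1}" "b \<in> {-1, 0, 1}" "a \<noteq> 0 \<or> b \<noteq> 0" for a b
  proof -
    have "dvec a b \<noteq> (\<lambda>i\<in>{..<2}. 0)"
      using that(3) dvec_eq_iff[of a b 0 0] by (simp add: dvec_def)
    then show ?thesis using that by (auto simp: directions_def dvec_def)
  qed
  then show "?D \<subseteq> directions 2" by simp
qed

lemma sum_directions_2:
  "(\<Sum>v\<in>directions 2. g v) = g (dvec (- 1) (- 1)) + g (dvec (- 1) 0) + g (dvec (- 1) 1) + g (dvec 0 1)
     + g (dvec 1 1) + g (dvec 1 0) + g (dvec 1 (- 1)) + g (dvec 0 (- 1))"
  unfolding directions_2 by (simp add: dvec_eq_iff add.assoc)

context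
  fixes n :: "nat \<Rightarrow> nat" and \<Gamma> :: "(nat \<Rightarrow> int) \<Rightarrow> 'a"
  assumes n_pos: "\<forall>j<2. 0 < n j"
begin

text \<open>The grid seen from \<open>p\<close>: sums over all \<open>p\<close> do not change when
  the pattern of inspected cells is translated.\<close>

definition cell :: "(nat \<Rightarrow> int) \<Rightarrow> int \<Rightarrow> int \<Rightarrow> 'a" where
  "cell p a b = \<Gamma> (tadd 2 n p (dvec a b))"

lemma cell_tadd: "cell (tadd 2 n p (dvec s t)) a b = cell p (a + s) (b + t)"
  unfolding cell_def tadd_tadd
  by (intro arg_cong[where f = \<Gamma>] tadd_cong) (auto simp: less_2_cases_iff dvec_apply)

lemma sum_cell_shift:
  "(\<Sum>p\<in>torus 2 n. \<Phi> (\<lambda>a b. cell p (a + s) (b + t))) = (\<Sum>p\<in>torus 2 n. \<Phi> (cell p))"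
  using sum_tadd[OF n_pos, of "\<lambda>p. \<Phi> (cell p)" "dvec s t"] by (simp add: cell_tadd[abs_def])

lemma sum_cell1: "(\<Sum>p\<in>torus 2 n. f (cell p s t)) = (\<Sum>p\<in>torus 2 n. f (cell p 0 0))"
  using sum_cell_shift[of "\<lambda>c. f (c 0 0)" s t] by simp

text \<open>Moving the first factor to the origin is a normal form in which translated patterns
  become the same term.\<close>

lemma sum_cell2:
  "(\<Sum>p\<in>torus 2 n. f (cell p s t) * g (cell p a b)) =
   (\<Sum>p\<in>torus 2 n. f (cell p 0 0) * g (cell p (a - s) (b - t)))"
  using sum_cell_shift[of "\<lambda>c. f (c 0 0) * g (c (a - s) (b - t))" s t] by simp

lemma sum_cell3:
  "(\<Sum>p\<in>torus 2 n. f (cell p s t) * g (cell p a b) * h (cell p a' b')) =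
   (\<Sum>p\<in>torus 2 n. f (cell p 0 0) * g (cell p (a - s) (b - t)) * h (cell p (a' - s) (b' - t)))"
  using sum_cell_shift[of "\<lambda>c. f (c 0 0) * g (c (a - s) (b - t)) * h (c (a' - s) (b' - t))" s t]
  by simp

text \<open>Only the letters next to index \<open>r\<close> are kept and the window is centred at
  that index, which bounds the count by a sum of local terms. Bounds for different \<open>r\<close>
  can be mixed.\<close>

lemma card_appearances_le_triples:
  assumes "Suc r < length w" "1 \<le> r"
    and \<phi>: "\<And>x y z. 0 \<le> \<phi> x y z" "1 \<le> \<phi> (w ! (r - 1)) (w ! r) (w ! Suc r)"
  shows "int (card (appearances 2 n \<Gamma> w)) \<le> (\<Sum>p\<in>torus 2 n.
      \<phi> (cell p 1 1) (cell p 0 0) (cell p (- 1) (- 1)) + \<phi> (cell p 1 0) (cell p 0 0) (cell p (- 1) 0)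
    + \<phi> (cell p 1 (- 1)) (cell p 0 0) (cell p (- 1) 1) + \<phi> (cell p 0 (- 1)) (cell p 0 0) (cell p 0 1)
    + \<phi> (cell p (- 1) (- 1)) (cell p 0 0) (cell p 1 1) + \<phi> (cell p (- 1) 0) (cell p 0 0) (cell p 1 0)
    + \<phi> (cell p (- 1) 1) (cell p 0 0) (cell p 1 (- 1)) + \<phi> (cell p 0 1) (cell p 0 0) (cell p 0 (- 1)))"
proof -
  let ?T = "torus 2 n"
  have dir: "(\<Sum>p\<in>?T. of_bool (\<forall>i<length w. \<Gamma> (tadd 2 n p (\<lambda>j. int i * dvec s t j)) = w ! i))
      \<le> (\<Sum>p\<in>?T. \<phi> (cell p (- s) (- t)) (cell p 0 0) (cell p s t))" for s t
  proof -
    have cell: "\<Gamma> (tadd 2 n p (\<lambda>j. int i * dvec s t j)) = cell p (int i * s) (int i * t)" for p i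
      unfolding cell_def
      by (intro arg_cong[where f = \<Gamma>] tadd_cong) (auto simp: less_2_cases_iff dvec_apply)
    have "(\<Sum>p\<in>?T. of_bool (\<forall>i<length w. \<Gamma> (tadd 2 n p (\<lambda>j. int i * dvec s t j)) = w ! i))
        \<le> (\<Sum>p\<in>?T. \<phi> (cell p (int (r - 1) * s) (int (r - 1) * t)) (cell p (int r * s) (int r * t))
            (cell p (int (Suc r) * s) (int (Suc r) * t)))"
    proof (rule sum_mono)
      fix p
      have idx: "r - 1 < length w" "r < length w" using assms by auto
      show "of_bool (\<forall>i<length w. \<Gamma> (tadd 2 n p (\<lambda>j. int i * dvec s t j)) = w ! i)
          \<le> \<phi> (cell p (int (r - 1) * s) (int (r - 1) * t)) (cell p (int r * s) (int r * t))
            (cell p (int (Suc r) * s) (int (Suc r) * t))"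
        unfolding cell using \<phi> assms(1) idx by (auto simp del: of_nat_Suc)
    qed
    also have "\<dots> = (\<Sum>p\<in>?T. \<phi> (cell p (- s) (- t)) (cell p 0 0) (cell p s t))"
      using sum_cell_shift[of "\<lambda>c. \<phi> (c (- s) (- t)) (c 0 0) (c s t)" "int r * s" "int r * t"] assms(2)
      by (simp add: of_nat_diff algebra_simps)
    finally show ?thesis .
  qed
  have "int (card (appearances 2 n \<Gamma> w)) = (\<Sum>p\<in>?T. \<Sum>v\<in>directions 2.
      of_bool (\<forall>i<length w. \<Gamma> (tadd 2 n p (\<lambda>j. int i * v j)) = w ! i))"
    unfolding card_appearances_sum of_nat_sum of_nat_of_bool ..
  also have "\<dots> \<le> (\<Sum>p\<in>?T.
      \<phi> (cell p 1 1) (cell p 0 0) (cell p (- 1) (- 1)) + \<phi> (cell p 1 0) (cell p 0 0) (cell p (- 1) 0)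
    + \<phi> (cell p 1 (- 1)) (cell p 0 0) (cell p (- 1) 1) + \<phi> (cell p 0 (- 1)) (cell p 0 0) (cell p 0 1)
    + \<phi> (cell p (- 1) (- 1)) (cell p 0 0) (cell p 1 1) + \<phi> (cell p (- 1) 0) (cell p 0 0) (cell p 1 0)
    + \<phi> (cell p (- 1) 1) (cell p 0 0) (cell p 1 (- 1)) + \<phi> (cell p 0 1) (cell p 0 0) (cell p 0 (- 1)))"
    unfolding sum_directions_2 sum.distrib
    using dir[of "- 1" "- 1"] dir[of "- 1" 0] dir[of "- 1" 1] dir[of 0 1]
      dir[of 1 1] dir[of 1 0] dir[of 1 "- 1"] dir[of 0 "- 1"]
    by (intro add_mono) (simp_all del: sum_of_bool_eq)
  finally show ?thesis .
qed

end

text \<open>The potentials below are dual certificates of the linear program that maximises the number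
  of counted words over shift-invariant distributions on \<open>3 \<times> 3\<close> windows. Each of them cancels
  when summed over all translates of the window. The argument \<open>x\<close> is the indicator of \<open>A\<close>, and
  \<open>a\<close> and \<open>c\<close> are the indicators of \<open>A\<close> and \<open>C\<close>, all other letters being counted as \<open>B\<close>.\<close>

definition AAB_potential :: "(int \<Rightarrow> int \<Rightarrow> int) \<Rightarrow> int" where
  "AAB_potential x =
      20 * x 0 0
      - 5 * (x (- 1) (- 1) + x (- 1) 1 + x 1 1 + x 1 (- 1))
      + 6 * (x (- 1) 0 * x 0 0 + x 0 0 * x 0 1 + x 0 0 * x 1 0 + x 0 (- 1) * x 0 0)
      - 3 * (x (- 1) (- 1) * x (- 1) 0 + x (- 1) (- 1) * x 0 (- 1) + x (- 1) 1 * x 0 1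
        + x (- 1) 0 * x (- 1) 1 + x 1 0 * x 1 1 + x 0 1 * x 1 1 + x 0 (- 1) * x 1 (- 1)
        + x 1 (- 1) * x 1 0)
      - 12 * (x (- 1) 0 * x 0 0 * x 1 0 + x 0 (- 1) * x 0 0 * x 0 1)
      + 6 * (x (- 1) (- 1) * x (- 1) 0 * x (- 1) 1 + x (- 1) 1 * x 0 1 * x 1 1
        + x 1 (- 1) * x 1 0 * x 1 1 + x (- 1) (- 1) * x 0 (- 1) * x 1 (- 1))
      - 2 * (x (- 1) 0 * x 1 0 + x 0 (- 1) * x 0 1)
      + (x (- 1) (- 1) * x (- 1) 1 + x (- 1) 1 * x 1 1 + x 1 (- 1) * x 1 1
        + x (- 1) (- 1) * x 1 (- 1))
      + (x (- 1) 0 * x 0 1 * x 1 0 + x 0 (- 1) * x 0 1 * x 1 0 + x (- 1) 0 * x 0 (- 1) * x 1 0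
        + x (- 1) 0 * x 0 (- 1) * x 0 1)
      - (x (- 1) (- 1) * x (- 1) 1 * x 0 0 + x (- 1) 1 * x 0 0 * x 1 1
        + x 0 0 * x 1 (- 1) * x 1 1 + x (- 1) (- 1) * x 0 0 * x 1 (- 1))
      - (x (- 1) (- 1) * x 0 0 + x (- 1) 1 * x 0 0 + x 0 0 * x 1 1 + x 0 0 * x 1 (- 1))
      + (x (- 1) 0 * x 0 1 + x 0 1 * x 1 0 + x 0 (- 1) * x 1 0 + x (- 1) 0 * x 0 (- 1))"

text \<open>A finite check over the 2^9 windows. The factor 9 clears the denominators of the
  certificate, and 18/9 = 2 is three times the one-dimensional value 2/3.\<close>

lemma window_AAB:
  assumes "\<And>s t. x s t = 0 \<or> x s t = 1"
  shows "9 * (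
      x 1 1 * x 0 0 * (1 - x (- 1) (- 1)) + x 1 0 * x 0 0 * (1 - x (- 1) 0)
        + x 1 (- 1) * x 0 0 * (1 - x (- 1) 1) + x 0 (- 1) * x 0 0 * (1 - x 0 1)
        + x (- 1) (- 1) * x 0 0 * (1 - x 1 1) + x (- 1) 0 * x 0 0 * (1 - x 1 0)
        + x (- 1) 1 * x 0 0 * (1 - x 1 (- 1)) + x 0 1 * x 0 0 * (1 - x 0 (- 1)))
    \<le> 18 + AAB_potential x"
  unfolding AAB_potential_def
  by (rule disjE[OF assms[of 0 0]]; simp?;
      rule disjE[OF assms[of "- 1" 0]]; simp?;
      rule disjE[OF assms[of 0 1]]; simp?;
      rule disjE[OF assms[of 1 0]]; simp?;
      rule disjE[OF assms[of 0 "- 1"]]; simp?;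
      rule disjE[OF assms[of "- 1" "- 1"]]; simp?;
      rule disjE[OF assms[of "- 1" 1]]; simp?;
      rule disjE[OF assms[of 1 1]]; simp?;
      rule disjE[OF assms[of 1 "- 1"]]; simp?)

section \<open>Window inequality for three letters\<close>

definition letter_codes :: "(int \<times> int) set" where
  "letter_codes = {(0, 0), (1, 0), (0, 1)}"

lemma letter_cases:
  assumes "(a, c) \<in> letter_codes"
  obtains "a = 0" "c = 0" | "a = 1" "c = 0" | "a = 0" "c = 1"
  using assms by (auto simp: letter_codes_def)

text \<open>In the next five lemmas the four corners, or the four edge cells, of the window are numbered
  in cyclic order. For centre \<open>B\<close> the two parts interact only through \<open>q\<close>, which marks the edge
  cells that are not \<open>B\<close>.\<close>

lemma corners_around_A:
  assumes "(a1, c1) \<in> letter_codes" "(a2, c2) \<in> letter_codes" "(a3, c3) \<in> letter_codes"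
    "(a4, c4) \<in> letter_codes"
  shows "10 * (a1 * (1 - a3 - c3) + a3 * (1 - a1 - c1) + a2 * (1 - a4 - c4) + a4 * (1 - a2 - c2))
    + 2 * (a1 + a2 + a3 + a4) + 3 * (c1 + c2 + c3 + c4)
    \<le> 18 + 6 * (a1 * a2 + a2 * a3 + a3 * a4 + a4 * a1) + 2 * (c1 * c2 + c2 * c3 + c3 * c4 + c4 * c1)"
  by (rule letter_cases[OF assms(1)]; simp?;
      rule letter_cases[OF assms(2)]; simp?;
      rule letter_cases[OF assms(3)]; simp?;
      rule letter_cases[OF assms(4)]; simp?)

lemma edges_around_A:
  assumes "(a1, c1) \<in> letter_codes" "(a2, c2) \<in> letter_codes" "(a3, c3) \<in> letter_codes"
    "(a4, c4) \<in> letter_codes"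
  shows "10 * (a1 * (1 - a3 - c3) + a3 * (1 - a1 - c1) + a2 * (1 - a4 - c4) + a4 * (1 - a2 - c2))
    + 6 * (c1 + c2 + c3 + c4) + 12 * (a1 * a3 + a2 * a4) + 4 * (c1 * c3 + c2 * c4)
    \<le> 18 + 2 * (a1 * a2 + a2 * a3 + a3 * a4 + a4 * a1) + 4 * (a1 * c2 + a2 * c3 + a3 * c4 + a4 * c1)
      + 4 * (c1 * a2 + c2 * a3 + c3 * a4 + c4 * a1) + 4 * (c1 * c2 + c2 * c3 + c3 * c4 + c4 * c1)"
  by (rule letter_cases[OF assms(1)]; simp?;
      rule letter_cases[OF assms(2)]; simp?;
      rule letter_cases[OF assms(3)]; simp?;
      rule letter_cases[OF assms(4)]; simp?)

lemma corners_around_B: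
  fixes q1 q2 q3 q4 :: int
  assumes "(a1, c1) \<in> letter_codes" "(a2, c2) \<in> letter_codes" "(a3, c3) \<in> letter_codes"
    "(a4, c4) \<in> letter_codes" and
    "q1 = 0 \<or> q1 = 1" "q2 = 0 \<or> q2 = 1" "q3 = 0 \<or> q3 = 1" "q4 = 0 \<or> q4 = 1"
  shows "20 * (a1 * c3 + a3 * c1 + a2 * c4 + a4 * c2)
    \<le> 22 - 6 * (q1 * q3 + q2 * q4)
      + c1 * (5 + 3 * (q4 + q1)) + c2 * (5 + 3 * (q1 + q2))
      + c3 * (5 + 3 * (q2 + q3)) + c4 * (5 + 3 * (q3 + q4))
      + 6 * (a1 * a2 + a2 * a3 + a3 * a4 + a4 * a1) + 2 * (c1 * c2 + c2 * c3 + c3 * c4 + c4 * c1)"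
  by (rule disjE[OF assms(5)]; simp?;
      rule disjE[OF assms(6)]; simp?;
      rule disjE[OF assms(7)]; simp?;
      rule disjE[OF assms(8)]; simp?;
      rule letter_cases[OF assms(1)]; simp?;
      rule letter_cases[OF assms(2)]; simp?;
      rule letter_cases[OF assms(3)]; simp?;
      rule letter_cases[OF assms(4)]; simp?)

lemma edges_around_B:
  assumes "(a1, c1) \<in> letter_codes" "(a2, c2) \<in> letter_codes" "(a3, c3) \<in> letter_codes"
    "(a4, c4) \<in> letter_codes"
  shows "20 * (a1 * c3 + a3 * c1 + a2 * c4 + a4 * c2)
    + 12 * (a1 * a3 + a2 * a4) + 4 * (c1 * c3 + c2 * c4)
    \<le> 14 + 6 * ((a1 + c1) * (a3 + c3) + (a2 + c2) * (a4 + c4))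
      + 2 * (a1 * a2 + a2 * a3 + a3 * a4 + a4 * a1) + 4 * (a1 * c2 + a2 * c3 + a3 * c4 + a4 * c1)
      + 4 * (c1 * a2 + c2 * a3 + c3 * a4 + c4 * a1) + 4 * (c1 * c2 + c2 * c3 + c3 * c4 + c4 * c1)"
  by (rule letter_cases[OF assms(1)]; simp?;
      rule letter_cases[OF assms(2)]; simp?;
      rule letter_cases[OF assms(3)]; simp?;
      rule letter_cases[OF assms(4)]; simp?)

lemma edges_around_C:
  assumes "(a1, c1) \<in> letter_codes" "(a2, c2) \<in> letter_codes" "(a3, c3) \<in> letter_codes"
    "(a4, c4) \<in> letter_codes"
  shows "6 * (c1 + c2 + c3 + c4) + 12 * (a1 * a3 + a2 * a4) + 4 * (c1 * c3 + c2 * c4)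
    \<le> 16 + 2 * (a1 * a2 + a2 * a3 + a3 * a4 + a4 * a1) + 4 * (a1 * c2 + a2 * c3 + a3 * c4 + a4 * c1)
      + 4 * (c1 * a2 + c2 * a3 + c3 * a4 + c4 * a1) + 4 * (c1 * c2 + c2 * c3 + c3 * c4 + c4 * c1)"
  by (rule letter_cases[OF assms(1)]; simp?;
      rule letter_cases[OF assms(2)]; simp?;
      rule letter_cases[OF assms(3)]; simp?;
      rule letter_cases[OF assms(4)]; simp?)

definition AABC_potential :: "(int \<Rightarrow> int \<Rightarrow> int) \<Rightarrow> (int \<Rightarrow> int \<Rightarrow> int) \<Rightarrow> int" where
  "AABC_potential a c =
      3 * (c (- 1) (- 1) * a (- 1) 0 + c (- 1) (- 1) * a 0 (- 1) + c (- 1) 1 * a 0 1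
        + a (- 1) 0 * c (- 1) 1 + a 1 0 * c 1 1 + a 0 1 * c 1 1 + a 0 (- 1) * c 1 (- 1)
        + c 1 (- 1) * a 1 0)
      - 6 * (c (- 1) 0 * a 0 0 + a 0 0 * c 0 1 + a 0 0 * c 1 0 + c 0 (- 1) * a 0 0)
      - 12 * (a (- 1) 0 * a 1 0 + a 0 (- 1) * a 0 1)
      + 6 * (a (- 1) (- 1) * a (- 1) 1 + a (- 1) 1 * a 1 1 + a 1 (- 1) * a 1 1
        + a (- 1) (- 1) * a 1 (- 1))
      - 2 * (a (- 1) (- 1) * a 0 0 + a (- 1) 1 * a 0 0 + a 0 0 * a 1 1 + a 0 0 * a 1 (- 1))
      + 2 * (a (- 1) 0 * a 0 1 + a 0 1 * a 1 0 + a 0 (- 1) * a 1 0 + a (- 1) 0 * a 0 (- 1))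
      - 8 * (c (- 1) (- 1) * a 0 0 + c (- 1) 1 * a 0 0 + a 0 0 * c 1 1 + a 0 0 * c 1 (- 1))
      + 4 * (a (- 1) 0 * c 0 1 + a 0 1 * c 1 0 + c 0 (- 1) * a 1 0 + c (- 1) 0 * a 0 (- 1)
        + c (- 1) 0 * a 0 1 + c 0 1 * a 1 0 + a 0 (- 1) * c 1 0 + a (- 1) 0 * c 0 (- 1))
      - 20 * c 0 0
      + 5 * (c (- 1) (- 1) + c (- 1) 1 + c 1 1 + c 1 (- 1))
      - 6 * (c (- 1) 0 * c 0 0 + c 0 0 * c 0 1 + c 0 0 * c 1 0 + c 0 (- 1) * c 0 0)
      + 3 * (c (- 1) (- 1) * c (- 1) 0 + c (- 1) (- 1) * c 0 (- 1) + c (- 1) 1 * c 0 1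
        + c (- 1) 0 * c (- 1) 1 + c 1 0 * c 1 1 + c 0 1 * c 1 1 + c 0 (- 1) * c 1 (- 1)
        + c 1 (- 1) * c 1 0)
      - 4 * (c (- 1) 0 * c 1 0 + c 0 (- 1) * c 0 1)
      + 2 * (c (- 1) (- 1) * c (- 1) 1 + c (- 1) 1 * c 1 1 + c 1 (- 1) * c 1 1
        + c (- 1) (- 1) * c 1 (- 1))
      - 4 * (c (- 1) (- 1) * c 0 0 + c (- 1) 1 * c 0 0 + c 0 0 * c 1 1 + c 0 0 * c 1 (- 1))
      + 4 * (c (- 1) 0 * c 0 1 + c 0 1 * c 1 0 + c 0 (- 1) * c 1 0 + c (- 1) 0 * c 0 (- 1))"

text \<open>The left side mixes two relaxations with weights 10 and 20, so the resulting bound is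
  36/30 = 6/5. Fixing the centre lets corners and edge cells be checked separately instead of all
  3^9 windows together.\<close>

lemma window_AABC:
  assumes codes: "\<And>s t. (a s t, c s t) \<in> letter_codes"
  shows "10 * a 0 0 * (
      a 1 1 * (1 - a (- 1) (- 1) - c (- 1) (- 1)) + a 1 0 * (1 - a (- 1) 0 - c (- 1) 0)
        + a 1 (- 1) * (1 - a (- 1) 1 - c (- 1) 1) + a 0 (- 1) * (1 - a 0 1 - c 0 1)
        + a (- 1) (- 1) * (1 - a 1 1 - c 1 1) + a (- 1) 0 * (1 - a 1 0 - c 1 0)
        + a (- 1) 1 * (1 - a 1 (- 1) - c 1 (- 1)) + a 0 1 * (1 - a 0 (- 1) - c 0 (- 1)))
    + 20 * (1 - a 0 0 - c 0 0) * (
      a 1 1 * c (- 1) (- 1) + a 1 0 * c (- 1) 0 + a 1 (- 1) * c (- 1) 1 + a 0 (- 1) * c 0 1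
        + a (- 1) (- 1) * c 1 1 + a (- 1) 0 * c 1 0 + a (- 1) 1 * c 1 (- 1) + a 0 1 * c 0 (- 1))
    \<le> 36 + AABC_potential a c"
proof -
  have q: "a s t + c s t = 0 \<or> a s t + c s t = 1" and ge: "0 \<le> a s t" "0 \<le> c s t" for s t
    using codes[of s t] by (auto simp: letter_codes_def)
  note corners = codes[of "- 1" "- 1"] codes[of "- 1" 1] codes[of 1 1] codes[of 1 "- 1"]
  note edges = codes[of "- 1" 0] codes[of 0 1] codes[of 1 0] codes[of 0 "- 1"]
  note q_edges = q[of "- 1" 0] q[of 0 1] q[of 1 0] q[of 0 "- 1"]
  have nonneg_A: "0 \<le> c (- 1) (- 1) * (a 0 (- 1) + c 0 (- 1) + a (- 1) 0 + c (- 1) 0)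
      + c (- 1) 1 * (a (- 1) 0 + c (- 1) 0 + a 0 1 + c 0 1)
      + c 1 1 * (a 0 1 + c 0 1 + a 1 0 + c 1 0)
      + c 1 (- 1) * (a 1 0 + c 1 0 + a 0 (- 1) + c 0 (- 1))"
    and nonneg_C: "0 \<le> c (- 1) (- 1) * (1 + 3 * (a 0 (- 1) + c 0 (- 1) + a (- 1) 0 + c (- 1) 0))
      + c (- 1) 1 * (1 + 3 * (a (- 1) 0 + c (- 1) 0 + a 0 1 + c 0 1))
      + c 1 1 * (1 + 3 * (a 0 1 + c 0 1 + a 1 0 + c 1 0))
      + c 1 (- 1) * (1 + 3 * (a 1 0 + c 1 0 + a 0 (- 1) + c 0 (- 1)))
      + 6 * (a (- 1) (- 1) * a (- 1) 1 + a (- 1) 1 * a 1 1 + a 1 1 * a 1 (- 1) + a 1 (- 1) * a (- 1) (- 1))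
      + 2 * (c (- 1) (- 1) * c (- 1) 1 + c (- 1) 1 * c 1 1 + c 1 1 * c 1 (- 1) + c 1 (- 1) * c (- 1) (- 1))"
    by (simp_all add: ge)
  show ?thesis
  proof (rule letter_cases[OF codes[of 0 0]])
    assume "a 0 0 = 0" "c 0 0 = 0"
    then show ?thesis
      using corners_around_B[OF corners q_edges] edges_around_B[OF edges]
      by (simp add: AABC_potential_def algebra_simps)
  next
    assume "a 0 0 = 1" "c 0 0 = 0"
    then show ?thesis
      using corners_around_A[OF corners] edges_around_A[OF edges] nonneg_A
      by (simp add: AABC_potential_def algebra_simps)
  next
    assume "a 0 0 = 0" "c 0 0 = 1"
    then show ?thesis
      using edges_around_C[OF edges] nonneg_C by (simp add: AABC_potential_def algebra_simps)
  qed
qed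

section \<open>Summing the window inequalities over the torus\<close>

lemma concentration_2_AAB_le:
  fixes A B :: 'a
  assumes "A \<noteq> B"
  shows "concentration 2 [A, A, B] \<le> 2"
proof (rule concentration_leI)
  fix n :: "nat \<Rightarrow> nat" and \<Gamma> :: "(nat \<Rightarrow> int) \<Rightarrow> 'a" assume n: "\<forall>i<2. 0 < n i"
  let ?T = "torus 2 n"
  define \<alpha> where "\<alpha> l = (of_bool (l = A) :: int)" for l
  define x where "x p s t = \<alpha> (cell n \<Gamma> p s t)" for p s t
  define M1 where "M1 = (\<Sum>p\<in>?T. x p 0 0)"
  define M2 where "M2 s t = (\<Sum>p\<in>?T. x p 0 0 * x p s t)" for s t
  define M3 where "M3 s t s' t' = (\<Sum>p\<in>?T. x p 0 0 * x p s t * x p s' t')" for s t s' t'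
  have S1: "(\<Sum>p\<in>?T. x p a b) = M1" for a b
    unfolding M1_def x_def by (rule sum_cell1[OF n])
  have S2: "(\<Sum>p\<in>?T. x p a b * x p s t) = M2 (s - a) (t - b)" for a b s t
    unfolding M2_def x_def by (rule sum_cell2[OF n])
  have S3: "(\<Sum>p\<in>?T. x p a b * x p s t * x p s' t') = M3 (s - a) (t - b) (s' - a) (t' - b)" for a b s t s' t'
    unfolding M3_def x_def by (rule sum_cell3[OF n])
  have x01: "x p s t = 0 \<or> x p s t = 1" for p s t
    by (simp add: x_def \<alpha>_def)
  let ?L = "\<lambda>p. x p 1 1 * x p 0 0 * (1 - x p (- 1) (- 1)) + x p 1 0 * x p 0 0 * (1 - x p (- 1) 0)
      + x p 1 (- 1) * x p 0 0 * (1 - x p (- 1) 1) + x p 0 (- 1) * x p 0 0 * (1 - x p 0 1)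
      + x p (- 1) (- 1) * x p 0 0 * (1 - x p 1 1) + x p (- 1) 0 * x p 0 0 * (1 - x p 1 0)
      + x p (- 1) 1 * x p 0 0 * (1 - x p 1 (- 1)) + x p 0 1 * x p 0 0 * (1 - x p 0 (- 1))"
  \<comment> \<open>The window is centred at the second \<open>A\<close>; the last letter is only
    required to differ from \<open>A\<close>.\<close>
  have "int (card (appearances 2 n \<Gamma> [A, A, B])) \<le> (\<Sum>p\<in>?T. ?L p)"
    using card_appearances_le_triples[OF n, of 1 "[A, A, B]" "\<lambda>x y z. \<alpha> x * \<alpha> y * (1 - \<alpha> z)" \<Gamma>] assms
    by (simp add: x_def \<alpha>_def)
  then have "9 * int (card (appearances 2 n \<Gamma> [A, A, B])) \<le> (\<Sum>p\<in>?T. 9 * ?L p)"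
    by (subst sum_distrib_left[symmetric]) simp
  also have "\<dots> \<le> (\<Sum>p\<in>?T. 18 + AAB_potential (x p))"
    by (intro sum_mono window_AAB x01)
  \<comment> \<open>Each product of the potential lists its positions in lexicographic order, so
    \<open>S1\<close>, \<open>S2\<close> and \<open>S3\<close> identify translates and everything
    but the constant cancels.\<close>
  also have "\<dots> = 18 * int (card ?T)"
    by (simp add: AAB_potential_def sum.distrib sum_subtractf S1 S2 S3 flip: sum_distrib_left)
  finally have "9 * int (card (appearances 2 n \<Gamma> [A, A, B])) \<le> 18 * int (card ?T)" .
  then show "real (card (appearances 2 n \<Gamma> [A, A, B])) \<le> 2 * real (card ?T)"
    by linarith
qed

lemma concentration_2_AABC_le:
  fixes A B C :: 'a
  assumes "A \<noteq> B" "A \<noteq> C" "B \<noteq> C"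
  shows "concentration 2 [A, A, B, C] \<le> 6 / 5"
proof (rule concentration_leI)
  fix n :: "nat \<Rightarrow> nat" and \<Gamma> :: "(nat \<Rightarrow> int) \<Rightarrow> 'a" assume n: "\<forall>i<2. 0 < n i"
  let ?T = "torus 2 n" and ?w = "[A, A, B, C]"
  define \<alpha> where "\<alpha> l = (of_bool (l = A) :: int)" for l
  define \<gamma> where "\<gamma> l = (of_bool (l = C) :: int)" for l
  define a where "a p s t = \<alpha> (cell n \<Gamma> p s t)" for p s t
  define c where "c p s t = \<gamma> (cell n \<Gamma> p s t)" for p s t
  define M where "M f g s t = (\<Sum>p\<in>?T. f p 0 0 * g p s t)"
    for f g :: "(nat \<Rightarrow> int) \<Rightarrow> int \<Rightarrow> int \<Rightarrow> int" and s t
  have S1: "(\<Sum>p\<in>?T. c p u v) = (\<Sum>p\<in>?T. c p 0 0)" if "u \<noteq> 0 \<or> v \<noteq> 0" for u v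
    unfolding c_def by (rule sum_cell1[OF n])
  have S2: "(\<Sum>p\<in>?T. a p u v * a p s t) = M a a (s - u) (t - v)"
      "(\<Sum>p\<in>?T. a p u v * c p s t) = M a c (s - u) (t - v)"
      "(\<Sum>p\<in>?T. c p u v * a p s t) = M c a (s - u) (t - v)"
      "(\<Sum>p\<in>?T. c p u v * c p s t) = M c c (s - u) (t - v)" for u v s t
    unfolding M_def a_def c_def by (rule sum_cell2[OF n])+
  have codes: "(a p s t, c p s t) \<in> letter_codes" for p s t
    using assms by (auto simp: a_def c_def \<alpha>_def \<gamma>_def letter_codes_def)
  let ?b = "\<lambda>p s t. 1 - a p s t - c p s t"
  let ?L1 = "\<lambda>p. a p 1 1 * ?b p (- 1) (- 1) + a p 1 0 * ?b p (- 1) 0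
      + a p 1 (- 1) * ?b p (- 1) 1 + a p 0 (- 1) * ?b p 0 1
      + a p (- 1) (- 1) * ?b p 1 1 + a p (- 1) 0 * ?b p 1 0
      + a p (- 1) 1 * ?b p 1 (- 1) + a p 0 1 * ?b p 0 (- 1)"
  let ?L2 = "\<lambda>p. a p 1 1 * c p (- 1) (- 1) + a p 1 0 * c p (- 1) 0
      + a p 1 (- 1) * c p (- 1) 1 + a p 0 (- 1) * c p 0 1
      + a p (- 1) (- 1) * c p 1 1 + a p (- 1) 0 * c p 1 0
      + a p (- 1) 1 * c p 1 (- 1) + a p 0 1 * c p 0 (- 1)"
  \<comment> \<open>The first relaxation keeps the letters \<open>A\<close>, \<open>A\<close>,
    \<open>B\<close>, centred at the second \<open>A\<close>; the next one keeps \<open>A\<close>,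
    \<open>B\<close>, \<open>C\<close>, centred at \<open>B\<close>.\<close>
  have "int (card (appearances 2 n \<Gamma> ?w)) \<le> (\<Sum>p\<in>?T. a p 0 0 * ?L1 p)"
    using card_appearances_le_triples[OF n, of 1 ?w "\<lambda>x y z. \<alpha> y * (\<alpha> x * (1 - \<alpha> z - \<gamma> z))" \<Gamma>] assms
    by (simp add: a_def c_def \<alpha>_def \<gamma>_def distrib_left)
  moreover have "int (card (appearances 2 n \<Gamma> ?w)) \<le> (\<Sum>p\<in>?T. ?b p 0 0 * ?L2 p)"
    using card_appearances_le_triples[OF n, of 2 ?w "\<lambda>x y z. (1 - \<alpha> y - \<gamma> y) * (\<alpha> x * \<gamma> z)" \<Gamma>] assms
    by (simp add: a_def c_def \<alpha>_def \<gamma>_def distrib_left)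
  ultimately have "30 * int (card (appearances 2 n \<Gamma> ?w)) \<le>
      10 * (\<Sum>p\<in>?T. a p 0 0 * ?L1 p) + 20 * (\<Sum>p\<in>?T. ?b p 0 0 * ?L2 p)"
    by linarith
  also have "\<dots> = (\<Sum>p\<in>?T. 10 * a p 0 0 * ?L1 p + 20 * ?b p 0 0 * ?L2 p)"
    unfolding sum_distrib_left sum.distrib by (simp only: mult.assoc)
  also have "\<dots> \<le> (\<Sum>p\<in>?T. 36 + AABC_potential (a p) (c p))"
    by (intro sum_mono window_AABC codes)
  also have "\<dots> = 36 * int (card ?T)"
    by (simp add: AABC_potential_def sum.distrib sum_subtractf S1 S2 flip: sum_distrib_left)
  finally have "30 * int (card (appearances 2 n \<Gamma> ?w)) \<le> 36 * int (card ?T)" .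
  then show "real (card (appearances 2 n \<Gamma> ?w)) \<le> 6 / 5 * real (card ?T)"
    by linarith
qed

section \<open>One letter followed by copies of another\<close>

text \<open>Appearances in the same direction are disjoint, since an overlap would put the first
  letter at a later index. So an appearance and an index determine a cell and a direction
  injectively.\<close>

lemma concentration_le_first_letter_unique:
  fixes w :: "'a list"
  assumes w: "w \<noteq> []" "\<And>i. 0 < i \<Longrightarrow> i < length w \<Longrightarrow> w ! i \<noteq> w ! 0"
  shows "concentration d w \<le> real (card (directions d)) / real (length w)"
proof (rule concentration_leI)
  fix n :: "nat \<Rightarrow> nat" and \<Gamma> :: "(nat \<Rightarrow> int) \<Rightarrow> 'a" assume n: "\<forall>i<d. 0 < n i"
  let ?A = "appearances d n \<Gamma> w" and ?l = "length w"
  define f where "f = (\<lambda>((p, v), s :: nat). (tadd d n p (\<lambda>j. int s * v j), v :: nat \<Rightarrow> int))"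
  have inj_aux: False
    if A: "(p, v) \<in> ?A" "(p', v) \<in> ?A" and st: "s < t" "t < ?l"
      and eq: "tadd d n p (\<lambda>j. int s * v j) = tadd d n p' (\<lambda>j. int t * v j)" for p p' v s t
  proof -
    have "p = tadd d n (tadd d n p (\<lambda>j. int s * v j)) (\<lambda>j. - (int s * v j))"
      using A(1) tadd_tadd_minus[OF n] by (simp add: mem_appearances)
    also have "\<dots> = tadd d n p' (\<lambda>j. int (t - s) * v j)"
      unfolding eq tadd_tadd by (rule tadd_cong) (use st in \<open>simp add: of_nat_diff algebra_simps\<close>)
    finally have "\<Gamma> p = w ! (t - s)"
      using A(2) st unfolding mem_appearances by (metis less_imp_diff_less)
    moreover have "tadd d n p (\<lambda>j. int 0 * v j) = p"
      by (rule tadd_zero) (use A(1) in \<open>auto simp: mem_appearances\<close>)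
    then have "\<Gamma> p = w ! 0" using A(1) w(1) unfolding mem_appearances by (metis length_greater_0_conv)
    ultimately show False using w(2)[of "t - s"] st by (metis less_imp_diff_less zero_less_diff)
  qed
  have inj: "inj_on f (?A \<times> {..<?l})"
  proof (rule inj_onI)
    fix x y assume xy: "x \<in> ?A \<times> {..<?l}" "y \<in> ?A \<times> {..<?l}" "f x = f y"
    obtain p v s p' v' t where x: "x = ((p, v), s)" and y: "y = ((p', v'), t)" by (metis surj_pair)
    have v': "v' = v" and eq: "tadd d n p (\<lambda>j. int s * v j) = tadd d n p' (\<lambda>j. int t * v j)"
      using xy by (auto simp: x y f_def)
    have A: "(p, v) \<in> ?A" "(p', v) \<in> ?A" "s < ?l" "t < ?l" using xy by (auto simp: x y v')
    have "s = t" using inj_aux[OF A(1,2)] inj_aux[OF A(2,1)] A(3,4) eq by (metis linorder_neqE_nat)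
    have "p \<in> torus d n" "p' \<in> torus d n" using A by (auto simp: mem_appearances)
    then have "p = p'" using eq tadd_tadd_minus[OF n] unfolding \<open>s = t\<close> by metis
    then show "x = y" using \<open>s = t\<close> by (simp add: x y v')
  qed
  have "card ?A * ?l = card (?A \<times> {..<?l})" by (simp add: card_cartesian_product)
  also have "\<dots> \<le> card (torus d n \<times> directions d)"
    by (rule card_inj_on_le[OF inj])
       (auto simp: f_def mem_appearances tadd_in_torus[OF n] finite_torus finite_directions)
  finally have "real (card ?A) * real ?l \<le> real (card (torus d n)) * real (card (directions d))"
    by (simp add: card_cartesian_product flip: of_nat_mult)
  then show "real (card ?A) \<le> real (card (directions d)) / real ?l * real (card (torus d n))"
    using w(1) by (simp add: field_simps)
qed

lemma dvec_in_torus: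
  "0 \<le> a \<Longrightarrow> a < int (n 0) \<Longrightarrow> 0 \<le> b \<Longrightarrow> b < int (n 1) \<Longrightarrow> dvec a b \<in> torus 2 n"
  unfolding torus_def dvec_def restrict_PiE_iff by (auto simp: less_2_cases_iff)

text \<open>Place \<open>A\<close> where x + 2y is divisible by \<open>m\<close>. A step in any of
  the eight directions changes x + 2y by 1, 2 or 3 up to sign, which is invertible modulo
  \<open>m\<close>; so the next \<open>A\<close> on each ray is \<open>m\<close> steps away, and
  every \<open>A\<close> starts eight appearances.\<close>

lemma concentration_2_AB_lattice:
  fixes A B :: 'a and m l :: nat
  assumes m: "coprime m 6" "l \<le> m" and l: "0 < l"
  shows "8 / real m \<le> concentration 2 (A # replicate (l - 1) B)"
proof -
  let ?n = "\<lambda>_ :: nat. m" and ?w = "A # replicate (l - 1) B"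
  define \<Gamma> where "\<Gamma> p = (if (p 0 + 2 * p 1) mod int m = 0 then A else B)" for p :: "nat \<Rightarrow> int"
  define S where "S = {p \<in> torus 2 ?n. (p 0 + 2 * p 1) mod int m = 0}"
  have m0: "0 < m" using m l by simp
  have "m \<le> card S"
  proof -
    \<comment> \<open>One \<open>A\<close> for each value of the second coordinate.\<close>
    define g where "g y = dvec ((- 2 * y) mod int m) y" for y
    have "g ` {0..<int m} \<subseteq> S"
      using m0 by (auto simp: S_def g_def dvec_in_torus dvec_apply mod_simps)
    moreover have "inj_on g {0..<int m}" by (auto simp: inj_on_def g_def dvec_eq_iff)
    moreover have "finite S" by (simp add: S_def finite_torus)
    ultimately show ?thesis using card_inj_on_le[of g "{0..<int m}" S] by simp
  qed
  moreover have "card (directions 2) = 8"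
    by (simp add: directions_2 dvec_eq_iff)
  ultimately have "8 * m \<le> card (S \<times> directions 2)" by (simp add: card_cartesian_product)
  also have "S \<times> directions 2 \<subseteq> appearances 2 ?n \<Gamma> ?w"
  proof
    fix x assume "x \<in> S \<times> directions 2"
    then obtain p v where x: "x = (p, v)" and p: "p \<in> S" and v: "v \<in> directions 2" by auto
    have mod_lin: "(a mod int m + 2 * (b mod int m)) mod int m = (a + 2 * b) mod int m" for a b
      by (metis mod_add_left_eq mod_add_right_eq mod_mult_right_eq)
    define k where "k = v 0 + 2 * v 1"
    have "k \<in> {1, 2, 3, -1, -2, -3}" using v by (auto simp: directions_2 k_def dvec_apply)
    moreover have "coprime (int m) 2" "coprime (int m) 3"
    proof -
      have "coprime m (2 * 3)" using m(1) by simp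
      then have "coprime m 2" "coprime m 3" unfolding coprime_mult_right_iff by simp_all
      then show "coprime (int m) 2" "coprime (int m) 3"
        by (metis coprime_int_iff of_nat_numeral)+
    qed
    ultimately have cop: "coprime (int m) k" by auto
    have "\<Gamma> (tadd 2 ?n p (\<lambda>j. int i * v j)) = ?w ! i" if i: "i < length ?w" for i
    proof -
      let ?q = "tadd 2 ?n p (\<lambda>j. int i * v j)"
      have "(?q 0 + 2 * ?q 1) mod int m = ((p 0 + 2 * p 1) mod int m + int i * k) mod int m"
      proof -
        have "(?q 0 + 2 * ?q 1) mod int m = ((p 0 + int i * v 0) + 2 * (p 1 + int i * v 1)) mod int m"
          using mod_lin[of "p 0 + int i * v 0" "p 1 + int i * v 1"] by (simp add: tadd_def)
        then show ?thesis unfolding k_def mod_add_left_eq by (simp add: algebra_simps)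
      qed
      then have q: "(?q 0 + 2 * ?q 1) mod int m = (int i * k) mod int m"
        using p by (simp add: S_def)
      show ?thesis
      proof (cases "i = 0")
        case True
        then show ?thesis using q by (simp add: \<Gamma>_def)
      next
        case False
        have "\<not> int m dvd int i * k"
        proof
          assume "int m dvd int i * k"
          then have "int m dvd int i" using cop by (simp add: coprime_dvd_mult_left_iff)
          then have "m \<le> i" using False by (simp add: dvd_imp_le)
          then show False using i m l by simp
        qed
        then show ?thesis using q False i by (simp add: \<Gamma>_def dvd_eq_mod_eq_0 nth_Cons')
      qed
    qed
    then show "x \<in> appearances 2 ?n \<Gamma> ?w" using p v by (simp add: x mem_appearances S_def)
  qed
  then have "card (S \<times> directions 2) \<le> card (appearances 2 ?n \<Gamma> ?w)"
    by (intro card_mono finite_appearances)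
  finally have *: "8 * m \<le> card (appearances 2 ?n \<Gamma> ?w)" .
  have "card (torus 2 ?n) = m * m" by (simp add: card_torus power2_eq_square)
  then have "8 / real m * real (card (torus 2 ?n)) = real (8 * m)" using m0 by simp
  then show ?thesis
    using m0 * by (intro concentration_geI[of 2 ?n _ \<Gamma>]) auto
qed

text \<open>No modulus is coprime to 6 and lies between 8 and 32/3, so length 8 needs its own grid. It
  has one \<open>A\<close> per row and column, placed such that 56 of the 64 pairs of an \<open>A\<close> and a direction
  are appearances.\<close>

definition eight_queens :: "int list" where
  "eight_queens = [2, 5, 1, 6, 4, 7, 3, 0]"

text \<open>States that \<open>AB^7\<close> appears at the \<open>A\<close> with first coordinate
  \<open>x\<close> in direction \<open>(a, b)\<close>, in a form that can be evaluated.\<close>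

definition queen_free :: "int \<times> int \<times> int \<Rightarrow> bool" where
  "queen_free = (\<lambda>(x, a, b). list_all (\<lambda>i. (eight_queens ! nat x + i * b) mod 8 \<noteq>
     eight_queens ! nat ((x + i * a) mod 8)) [1, 2, 3, 4, 5, 6, 7])"

definition queen_rays :: "(int \<times> int \<times> int) list" where
  "queen_rays = filter queen_free (List.product [0, 1, 2, 3, 4, 5, 6, 7]
     [(- 1, - 1), (- 1, 0), (- 1, 1), (0, 1), (1, 1), (1, 0), (1, - 1), (0, - 1)])"

lemma length_queen_rays: "length queen_rays = 56"
  by code_simp

text \<open>56 appearances on 64 cells give 7/8, more than the value 3 * 2/8 allowed by
  stacking.\<close>

lemma concentration_2_AB7: "7 / 8 \<le> concentration 2 (A # replicate 7 B)"
proof -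
  let ?n = "\<lambda>_ :: nat. 8 :: nat" and ?w = "A # replicate 7 B"
  define \<Gamma> where "\<Gamma> p = (if p 1 = eight_queens ! nat (p 0) then A else B)" for p :: "nat \<Rightarrow> int"
  define g where "g = (\<lambda>(x, a, b). (dvec x (eight_queens ! nat x), dvec a b))"
  have "distinct queen_rays"
    unfolding queen_rays_def by (intro distinct_filter distinct_product) auto
  then have "56 = card (set queen_rays)" by (simp add: distinct_card length_queen_rays)
  also have "\<dots> \<le> card (appearances 2 ?n \<Gamma> ?w)"
  proof (rule card_inj_on_le[OF _ _ finite_appearances])
    show "inj_on g (set queen_rays)" by (auto simp: inj_on_def g_def dvec_eq_iff)
    show "g ` set queen_rays \<subseteq> appearances 2 ?n \<Gamma> ?w"
    proof (rule image_subsetI)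
      fix z assume z: "z \<in> set queen_rays"
      obtain x a b where zx: "z = (x, a, b)" by (metis surj_pair)
      have z': "z \<in> set [0, 1, 2, 3, 4, 5, 6, 7] \<times> set [(- 1, - 1), (- 1, 0), (- 1, 1), (0, 1),
          (1, 1), (1, 0), (1, - 1), (0, - 1)] \<and> queen_free z"
        using z unfolding queen_rays_def set_filter List.set_product mem_Collect_eq .
      let ?y = "eight_queens ! nat x"
      have x: "x \<in> {0, 1, 2, 3, 4, 5, 6, 7}" and dir: "dvec a b \<in> directions 2" and free: "queen_free (x, a, b)"
        using z' by (auto simp: zx directions_2)
      have "?y \<in> {0..<8}" using x by (auto simp: eight_queens_def)
      then have t: "dvec x ?y \<in> torus 2 ?n" using x by (auto intro!: dvec_in_torus)
      have "\<Gamma> (tadd 2 ?n (dvec x ?y) (\<lambda>j. int i * dvec a b j)) = ?w ! i" if i: "i < 8" for i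
      proof (cases "i = 0")
        case True
        then show ?thesis using tadd_zero[OF t, of "\<lambda>_. 0"] by (simp add: \<Gamma>_def dvec_apply)
      next
        case False
        then have "int i \<in> set [1, 2, 3, 4, 5, 6, 7]" using i by auto
        then have "(?y + int i * b) mod 8 \<noteq> eight_queens ! nat ((x + int i * a) mod 8)"
          using free unfolding queen_free_def list_all_iff by blast
        then show ?thesis using False i by (simp add: \<Gamma>_def tadd_def dvec_apply nth_Cons')
      qed
      then show "g z \<in> appearances 2 ?n \<Gamma> ?w" using t dir by (simp add: zx g_def mem_appearances)
    qed
  qed
  finally have "56 \<le> card (appearances 2 ?n \<Gamma> ?w)" .
  moreover have "card (torus 2 ?n) = 64" by (simp add: card_torus)
  ultimately show ?thesis by (intro concentration_geI[of 2 ?n _ \<Gamma>]) auto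
qed

lemma not_stackable_AB:
  fixes A B :: 'a
  assumes l: "l > 3" and "A \<noteq> B"
  shows "\<not> stackable 2 (A # replicate (l - 1) B)"
proof -
  let ?w = "A # replicate (l - 1) B"
  have "card (directions 1) = 2"
    by (simp add: directions_1 fun_eq_iff del: One_nat_def)
  moreover have "length ?w = l" using l by simp
  ultimately have "concentration 1 ?w \<le> 2 / real l"
    using concentration_le_first_letter_unique[of ?w 1] assms(2) by (auto simp: nth_Cons' simp del: One_nat_def)
  \<comment> \<open>Stackability would cap the plane concentration at 6/l.\<close>
  moreover have "6 / real l < concentration 2 ?w"
  proof (cases "l = 8")
    case True
    then show ?thesis using concentration_2_AB7[of A B] by simp
  next
    case False
    \<comment> \<open>The least \<open>r\<close> is at most 3, with 3 occurring only for
      \<open>l\<close> congruent to 2 modulo 6; the condition \<open>3 * r < l\<close>, equivalent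
      to 3(l + r) < 4l, then fails only at 8.\<close>
    have "\<exists>r. ((l + r) mod 6 = 1 \<or> (l + r) mod 6 = 5) \<and> 3 * r < l"
      using l False by presburger
    then obtain r where r: "(l + r) mod 6 = 1 \<or> (l + r) mod 6 = 5" "3 * r < l" by blast
    define m where "m = l + r"
    have "gcd m 6 = gcd 6 (m mod 6)" by (rule gcd_red_nat)
    also have "\<dots> = 1" using r(1) by (auto simp: m_def gcd_non_0_nat)
    finally have m: "coprime m 6" "l \<le> m" "3 * m < 4 * l"
      using r(2) by (auto simp: m_def coprime_iff_gcd_eq_1)
    have "6 / real l < 8 / real m" using m l by (simp add: field_simps)
    then show ?thesis using concentration_2_AB_lattice[OF m(1,2), of A B] l by simp
  qed
  ultimately show ?thesis unfolding stackable_def by auto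
qed

section \<open>Words of length at most four\<close>

lemma card_line_hits_ge_1: "x \<in> line_hits m h w s \<Longrightarrow> 1 \<le> card (line_hits m h w s)"
  using finite_line_hits by (metis One_nat_def Suc_leI card_gt_0_iff empty_iff)

lemma concentration_1_ge_two_hits:
  assumes "u \<noteq> []" "x \<in> line_hits (length u) (\<lambda>x. u ! nat x) w 1"
    "y \<in> line_hits (length u) (\<lambda>x. u ! nat x) w (- 1)"
  shows "2 / real (length u) \<le> concentration 1 w"
  using assms(1) card_line_hits_ge_1[OF assms(2)] card_line_hits_ge_1[OF assms(3)]
  by (intro concentration_1_geI[of "length u" _ "\<lambda>x. u ! nat x"]) auto

lemma concentration_1_ge_one_hit:
  assumes "u \<noteq> []" "x \<in> line_hits (length u) (\<lambda>x. u ! nat x) w 1"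
  shows "1 / real (length u) \<le> concentration 1 w"
  using assms(1) card_line_hits_ge_1[OF assms(2)]
  by (intro concentration_1_geI[of "length u" _ "\<lambda>x. u ! nat x"]) auto

lemma stackable_2I: "concentration 2 w \<le> 3 * c \<Longrightarrow> c \<le> concentration 1 w \<Longrightarrow> stackable 2 w"
  using stackable_iff_le[of 2 w] by simp

lemma stackable_2_AAB:
  assumes "A \<noteq> B" shows "stackable 2 [A, A, B]"
proof (rule stackable_2I)
  show "concentration 2 [A, A, B] \<le> 3 * (2 / 3)" using concentration_2_AAB_le[OF assms] by simp
  show "2 / 3 \<le> concentration 1 [A, A, B]"
    using concentration_1_ge_two_hits[of "[A, A, B]" 0 "[A, A, B]" 1]
    by (simp add: line_hits_def All_less_Suc)
qed

lemma stackable_2_AABA: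
  assumes "A \<noteq> B" shows "stackable 2 [A, A, B, A]"
proof (rule stackable_2I)
  show "concentration 2 [A, A, B, A] \<le> 3 * (2 / 3)"
    using concentration_2_AAB_le[OF assms] concentration_append_le[of 2 "[A, A, B]" "[A]"] by simp
  show "2 / 3 \<le> concentration 1 [A, A, B, A]"
    using concentration_1_ge_two_hits[of "[A, A, B]" 0 "[A, A, B, A]" 1]
    by (simp add: line_hits_def All_less_Suc)
qed

lemma concentration_2_ABBA_le:
  assumes "A \<noteq> B" shows "concentration 2 [A, B, B, A] \<le> 2"
  using concentration_2_AAB_le[of B A] assms concentration_append_le[of 2 "[A, B, B]" "[A]"]
    concentration_rev[of 2 "[A, B, B]"] by simp

lemma stackable_2_ABBA:
  assumes "A \<noteq> B" shows "stackable 2 [A, B, B, A]"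
proof (rule stackable_2I)
  show "concentration 2 [A, B, B, A] \<le> 3 * (2 / 3)" using concentration_2_ABBA_le[OF assms] by simp
  show "2 / 3 \<le> concentration 1 [A, B, B, A]"
    using concentration_1_ge_two_hits[of "[A, B, B]" 0 "[A, B, B, A]" 0]
    by (simp add: line_hits_def All_less_Suc)
qed

text \<open>Replacing \<open>C\<close> by \<open>A\<close> gives the palindrome \<open>ABBA\<close>,
  so the bound for \<open>ABBA\<close> is halved.\<close>

lemma stackable_2_ABBC:
  assumes "A \<noteq> B" "A \<noteq> C" "B \<noteq> C" shows "stackable 2 [A, B, B, C]"
proof (rule stackable_2I)
  show "concentration 2 [A, B, B, C] \<le> 3 * (1 / 3)"
    using concentration_map_palindrome[of "id(C := A)" "[A, B, B, C]" 2]
      concentration_2_ABBA_le[of A B] assms by simp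
  show "1 / 3 \<le> concentration 1 [A, B, B, C]"
    \<comment> \<open>The cyclic word runs from \<open>A\<close> to \<open>C\<close> and back, so it
      reads the same in both directions from \<open>A\<close>.\<close>
    using concentration_1_ge_two_hits[of "[A, B, B, C, B, B]" 0 "[A, B, B, C]" 0]
    by (simp add: line_hits_def All_less_Suc)
qed

text \<open>Here replacing \<open>C\<close> by \<open>B\<close> gives \<open>ABBA\<close>; halving
  its bound leaves 1, which a single reading per period of length 3 matches.\<close>

lemma stackable_2_ABCA:
  assumes "A \<noteq> B" "A \<noteq> C" "B \<noteq> C" shows "stackable 2 [A, B, C, A]"
proof (rule stackable_2I)
  show "concentration 2 [A, B, C, A] \<le> 3 * (1 / 3)"
    using concentration_map_palindrome[of "id(C := B)" "[A, B, C, A]" 2]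
      concentration_2_ABBA_le[of A B] assms by simp
  show "1 / 3 \<le> concentration 1 [A, B, C, A]"
    using concentration_1_ge_one_hit[of "[A, B, C]" 0 "[A, B, C, A]"]
    by (simp add: line_hits_def All_less_Suc)
qed

lemma stackable_2_AABC:
  assumes "A \<noteq> B" "A \<noteq> C" "B \<noteq> C" shows "stackable 2 [A, A, B, C]"
proof (rule stackable_2I)
  show "concentration 2 [A, A, B, C] \<le> 3 * (2 / 5)"
    using concentration_2_AABC_le[OF assms] by simp
  show "2 / 5 \<le> concentration 1 [A, A, B, C]"
    \<comment> \<open>The backward reading starts at the second \<open>A\<close> and wraps around to
      the final \<open>B\<close>.\<close>
    using concentration_1_ge_two_hits[of "[A, A, B, C, B]" 0 "[A, A, B, C]" 1]
    by (simp add: line_hits_def All_less_Suc)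
qed

lemma stackable_2_AABB:
  assumes "A \<noteq> B" shows "stackable 2 [A, A, B, B]"
proof -
  have w: "is_word [A, B]" using assms by (auto simp: is_word_def)
  have "stackable 2 [A, B]"
    by (rule stackable_if_parity_separated[OF w]) (use assms in \<open>auto simp: less_Suc_eq\<close>)
  then have "stackable 2 (repeat_letters 2 [A, B])"
    by (intro stackable_repeat_letters w) auto
  then show ?thesis by (simp add: repeat_letters_def numeral_2_eq_2)
qed

lemma stackable_2_short:
  assumes w: "is_word w" and len: "length w \<le> 4"
  shows "stackable 2 w \<longleftrightarrow> \<not> (\<exists>A B. A \<noteq> B \<and> (w = [A, B, B, B] \<or> w = [B, B, B, A]))"
proof
  assume st: "stackable 2 w"
  have ABBB: "\<not> stackable 2 [A, B, B, B]" if "A \<noteq> B" for A B :: 'a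
    using not_stackable_AB[of 4 A B] that by (simp add: numeral_3_eq_3)
  then have "\<not> stackable 2 [B, B, B, A]" if "A \<noteq> B" for A B :: 'a
    using stackable_rev[of 2 "[A, B, B, B]"] that by simp
  then show "\<not> (\<exists>A B. A \<noteq> B \<and> (w = [A, B, B, B] \<or> w = [B, B, B, A]))"
    using ABBB st by blast
next
  assume ex: "\<not> (\<exists>A B. A \<noteq> B \<and> (w = [A, B, B, B] \<or> w = [B, B, B, A]))"
  consider a b where "w = [a, b]" | a b c where "w = [a, b, c]" | a b c e where "w = [a, b, c, e]"
  proof -
    have "length w = 2 \<or> length w = 3 \<or> length w = 4" using is_word_length[OF w] len by linarith
    then show ?thesis using that by (auto simp: length_Suc_conv eval_nat_numeral)
  qed
  then show "stackable 2 w"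
  proof cases
    case 1
    then have "a \<noteq> b" using w by (auto simp: is_word_def)
    then show ?thesis
      unfolding 1 using w 1 by (intro stackable_if_parity_separated) (auto simp: less_Suc_eq)
  next
    case 2
    consider "a = b" "b \<noteq> c" | "a \<noteq> b" "b = c" | "a \<noteq> b" "b \<noteq> c"
      using w by (auto simp: 2 is_word_def)
    then show ?thesis
    proof cases
      case 3
      then show ?thesis
        unfolding 2 using w 2 by (intro stackable_if_parity_separated) (auto simp: less_Suc_eq)
    qed (use stackable_2_AAB[of b c] stackable_2_AAB[of b a] stackable_rev[of 2 "[a, b, b]"] in \<open>auto simp: 2\<close>)
  next
    case 3
    \<comment> \<open>The split is by the first pair of equal neighbours. Without such a pair,
      either the outer letters agree, or letters of odd and even index are disjoint.\<close>
    consider "a = b" | "a \<noteq> b" "b = c" | "a \<noteq> b" "b \<noteq> c" "c = e" | "a \<noteq> b" "b \<noteq> c" "c \<noteq> e" "a = e"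
      | "a \<noteq> b" "b \<noteq> c" "c \<noteq> e" "a \<noteq> e" by blast
    then show ?thesis
    proof cases
      case 1
      \<comment> \<open>Otherwise the word would be constant or three equal letters followed by
        another one.\<close>
      have "c \<noteq> a" using ex w by (auto simp: 3 1 is_word_def)
      then show ?thesis
        using stackable_2_AABA[of a c] stackable_2_AABB[of a c] stackable_2_AABC[of a c e]
        by (cases "e = a"; cases "e = c") (auto simp: 3 1)
    next
      case 2
      have "e \<noteq> b" using ex 2 by (auto simp: 3)
      then show ?thesis
        using 2 stackable_2_ABBA[of a b] stackable_2_ABBC[of a b e] by (cases "e = a") (auto simp: 3)
    next
      case c: 3
      \<comment> \<open>The reversed word starts with the equal pair.\<close>
      have "stackable 2 [c, c, b, a]"
        using c stackable_2_AABA[of c b] stackable_2_AABC[of c b a] by (cases "a = c") auto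
      then show ?thesis using stackable_rev[of 2 "[a, b, c, c]"] c by (simp add: 3)
    next
      case 4
      then show ?thesis using stackable_2_ABCA[of a b c] by (auto simp: 3)
    next
      case 5
      then show ?thesis
        unfolding 3 using w 3 by (intro stackable_if_parity_separated) (auto simp: less_Suc_eq)
    qed
  qed
qed

theorem theorem1p4:
  shows
    "(\<forall>w :: 'a list. is_word w \<longrightarrow>
        (\<forall>i<length w. \<forall>j<length w. odd i \<and> even j \<longrightarrow> w ! i \<noteq> w ! j) \<longrightarrow>
        (\<forall>d\<ge>1. stackable d w))
     \<and> (\<forall>(w :: 'a list) d k. is_word w \<longrightarrow> d \<ge> 1 \<longrightarrow> k \<ge> 1 \<longrightarrow> stackable d w \<longrightarrow>
          stackable d (repeat_letters k w))
     \<and> (\<forall>w :: 'a list. is_word w \<longrightarrow> length w \<le> 4 \<longrightarrow>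
          (stackable 2 w \<longleftrightarrow>
            \<not> (\<exists>A B. A \<noteq> B \<and> (w = [A, B, B, B] \<or> w = [B, B, B, A]))))
     \<and> (\<forall>(l::nat) (A::'a) B. l > 3 \<longrightarrow> A \<noteq> B \<longrightarrow>
          \<not> stackable 2 (A # replicate (l - 1) B))"
proof (intro conjI allI impI)
  fix w :: "'a list" and d :: nat
  assume "is_word w" "\<forall>i<length w. \<forall>j<length w. odd i \<and> even j \<longrightarrow> w ! i \<noteq> w ! j" "1 \<le> d"
  then show "stackable d w" by (intro stackable_if_parity_separated) auto
qed (simp_all only: stackable_repeat_letters stackable_2_short not_stackable_AB not_False_eq_True)

end
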